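(* Let $(X_n)_{n\in\mathbb N}$ be a sequence of Banach spaces, let $\mathcal U$ be a free ultrafilter over $\mathbb N$ and let $\alpha>0$. Set $X:=(X_n)_{\mathcal U}$ and assume that every slice of $B_X$ has diameter at least $\alpha$. Then, for every $\delta>0$ and every $\varepsilon>0$ there exists $n\in\mathbb N$ such that $$\{k\in\mathbb N: C_n^{\alpha-\varepsilon}(X_k)<\delta\}\in\mathcal U.$$
   Context: Banach spaces are over the scalar field $\mathbb R$ or $\mathbb C$ and are assumed non-zero. For a Banach space $X$, $B_X$ and $S_X$ denote the closed unit ball and the unit sphere, and $X^*$ the topological dual. A slice of $B_X$ is a set of the form $\{x\in B_X: \operatorname{Re} f(x)>\sup_{y\in B_X} \operatorname{Re} f(y)-\beta\}$ with $f\in X^*$ and $\beta>0$. For $n\in\mathbb N$ and a subset $C$ of $X$, $\operatorname{conv}_n(C):=\{\sum_{i=1}^n\lambda_i x_i: \lambda_1,\ldots,\lambda_n\in[0,1],\ \sum_{i=1}^n\lambda_i=1,\ x_1,\ldots,x_n\in C\}$. For a real number $\alpha$ and $n\in\mathbb N$ put $$S^\alpha(X):=\left\{\tfrac{x+y}{2}: x,y\in B_X,\ \Vert x-y\Vert\geq\alpha\right\},\qquad S_n^\alpha(X):=\operatorname{conv}_n(S^\alpha(X)),$$ $$C_n^\alpha(X):=\sup_{x\in S_X}\ \inf_{y\in S_n^\alpha(X)}\Vert x-y\Vert,$$ with the convention that the infimum over the empty set is $+\infty$. Given Banach spaces $X_n$ ($n\in\mathbb N$) and a free ultrafilter $\mathcal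 U$ over $\mathbb N$, the ultraproduct is the quotient Banach space $(X_n)_{\mathcal U}:=\ell_\infty(\mathbb N,X_n)/c_{0,\mathcal U}(\mathbb N,X_n)$, where $\ell_\infty(\mathbb N,X_n)$ is the space of all sequences $(x_n)$ with $x_n\in X_n$ and $\sup_n\Vert x_n\Vert<\infty$ (sup norm), and $c_{0,\mathcal U}(\mathbb N,X_n)$ is the subspace of those with $\lim_{\mathcal U}\Vert x_n\Vert=0$. The norm satisfies $\Vert(x_n)_{\mathcal U}\Vert=\lim_{\mathcal U}\Vert x_n\Vert$. *)

theory Defs
  imports "HOL-Analysis.Analysis" "HOL-Algebra.Module" "HOL-Algebra.AbelCoset"
begin

text \<open>
  The axiom says that the field is \<open>\<real>\<close> or \<open>\<complex>\<close> with its usual absolute value. In the second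
  case \<open>i\<close> is not real, so the decomposition of \<open>z\<close> is unique and \<open>re_part\<close> is the real part.
\<close>

class real_or_complex = real_normed_field +
  fixes re_part :: "'a \<Rightarrow> real"
  assumes real_or_complex:
    "(\<forall>z. z = re_part z *\<^sub>R 1) \<or>
     (\<exists>i. i * i = - 1 \<and>
       (\<forall>z. \<exists>b. z = re_part z *\<^sub>R 1 + b *\<^sub>R i \<and>
              norm z = sqrt ((re_part z)\<^sup>2 + b\<^sup>2)))"

instantiation real :: real_or_complex
begin

definition re_part_real :: "real \<Rightarrow> real" where
  "re_part_real x = x"

instance
  by standard (simp add: re_part_real_def)

end

instantiation complex :: real_or_complex
begin

definition re_part_complex :: "complex \<Rightarrow> real" where
  "re_part_complex z = Re z"

instance
proof
  have "z = re_part z *\<^sub>R 1 + Im z *\<^sub>R \<i> \<and>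
      norm z = sqrt ((re_part z)\<^sup>2 + (Im z)\<^sup>2)" for z :: complex
    by (simp add: re_part_complex_def complex_eq_iff cmod_def)
  then show "(\<forall>z::complex. z = re_part z *\<^sub>R 1) \<or>
     (\<exists>i::complex. i * i = - 1 \<and>
       (\<forall>z. \<exists>b. z = re_part z *\<^sub>R 1 + b *\<^sub>R i \<and>
              norm z = sqrt ((re_part z)\<^sup>2 + b\<^sup>2)))"
    using i_squared by blast
qed

end

definition scalar_ring :: "'k::field ring" where
  "scalar_ring = \<lparr>carrier = UNIV, monoid.mult = (*), one = 1, ring.zero = 0, add = (+)\<rparr>"

text \<open>
  Spaces have explicit carriers, since a sequence of spaces and quotients by subspaces are needed.
  As for every \<^type>\<open>module_scheme\<close>, the fields \<open>mult\<close> and \<open>one\<close> of the record are irrelevant.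
\<close>

record ('k, 'a) normed_module = "('k, 'a) module" +
  vnorm :: "'a \<Rightarrow> real"

locale normed_space = module scalar_ring V
  for V :: "('k::real_or_complex, 'a, 'm) normed_module_scheme" (structure) +
  assumes vnorm_eq_zero_iff:
      "x \<in> carrier V \<Longrightarrow> vnorm V x = 0 \<longleftrightarrow> x = \<zero>"
    and vnorm_triangle:
      "x \<in> carrier V \<Longrightarrow> y \<in> carrier V \<Longrightarrow> vnorm V (x \<oplus> y) \<le> vnorm V x + vnorm V y"
    and vnorm_smult:
      "x \<in> carrier V \<Longrightarrow> vnorm V (a \<odot> x) = norm a * vnorm V x"

definition vdist :: "('k, 'a, 'm) normed_module_scheme \<Rightarrow> 'a \<Rightarrow> 'a \<Rightarrow> real" where
  "vdist V x y = vnorm V (x \<ominus>\<^bsub>V\<^esub> y)"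

locale banach_space = normed_space +
  assumes complete: "Metric_space.mcomplete (carrier V) (vdist V)"
    and nonzero: "carrier V \<noteq> {\<zero>}"

definition unit_ball :: "('k, 'a, 'm) normed_module_scheme \<Rightarrow> 'a set" where
  "unit_ball V = {x \<in> carrier V. vnorm V x \<le> 1}"

definition unit_sphere :: "('k, 'a, 'm) normed_module_scheme \<Rightarrow> 'a set" where
  "unit_sphere V = {x \<in> carrier V. vnorm V x = 1}"

definition dual :: "('k::real_normed_field, 'a, 'm) normed_module_scheme \<Rightarrow> ('a \<Rightarrow> 'k) set" where
  "dual V = {f.
     (\<forall>x\<in>carrier V. \<forall>y\<in>carrier V. f (x \<oplus>\<^bsub>V\<^esub> y) = f x + f y) \<and>
     (\<forall>a. \<forall>x\<in>carrier V. f (a \<odot>\<^bsub>V\<^esub> x) = a * f x) \<and>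
     (\<exists>K. \<forall>x\<in>carrier V. norm (f x) \<le> K * vnorm V x)}"

definition slices :: "('k::real_or_complex, 'a, 'm) normed_module_scheme \<Rightarrow> 'a set set" where
  "slices V =
     {{x \<in> unit_ball V. re_part (f x) > (SUP y\<in>unit_ball V. re_part (f y)) - \<beta>} | f \<beta>.
        f \<in> dual V \<and> \<beta> > 0}"

text \<open>
  Like \<^const>\<open>diameter\<close>, this is a supremum in the reals, hence meaningful for bounded sets only.
\<close>

definition vdiameter :: "('k, 'a, 'm) normed_module_scheme \<Rightarrow> 'a set \<Rightarrow> real" where
  "vdiameter V S = (if S = {} then 0 else SUP (x, y)\<in>S \<times> S. vdist V x y)"

definition conv_n ::
    "('k::real_normed_field, 'a, 'm) normed_module_scheme \<Rightarrow> nat \<Rightarrow> 'a set \<Rightarrow> 'a set" where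
  "conv_n V n C =
     {\<Oplus>\<^bsub>V\<^esub>i\<in>{1..n}. of_real (l i) \<odot>\<^bsub>V\<^esub> x i | (l :: nat \<Rightarrow> real) x.
        (\<forall>i\<in>{1..n}. l i \<in> {0..1}) \<and> (\<Sum>i=1..n. l i) = 1 \<and> (\<forall>i\<in>{1..n}. x i \<in> C)}"

definition S_mid ::
    "('k::real_normed_field, 'a, 'm) normed_module_scheme \<Rightarrow> real \<Rightarrow> 'a set" where
  "S_mid V \<alpha> =
     {(1 / 2) \<odot>\<^bsub>V\<^esub> (x \<oplus>\<^bsub>V\<^esub> y) | x y.
        x \<in> unit_ball V \<and> y \<in> unit_ball V \<and> vdist V x y \<ge> \<alpha>}"

text \<open>In \<^typ>\<open>ereal\<close> the infimum over the empty set is \<open>\<infinity>\<close>.\<close>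

definition C_const ::
    "('k::real_normed_field, 'a, 'm) normed_module_scheme \<Rightarrow> nat \<Rightarrow> real \<Rightarrow> ereal" where
  "C_const V n \<alpha> =
     (SUP x\<in>unit_sphere V. INF y\<in>conv_n V n (S_mid V \<alpha>). ereal (vdist V x y))"

text \<open>
  Ultrafilters are represented by the type \<^typ>\<open>nat filter\<close>: a set \<open>A\<close> belongs to \<open>U\<close> iff
  \<open>eventually (\<lambda>k. k \<in> A) U\<close>. The last condition says that the intersection of all sets
  of \<open>U\<close> is empty.
\<close>

definition free_ultrafilter :: "'i filter \<Rightarrow> bool" where
  "free_ultrafilter U \<longleftrightarrow>
     U \<noteq> bot \<and>
     (\<forall>P. eventually P U \<or> eventually (\<lambda>k. \<not> P k) U) \<and>
     (\<forall>i. eventually (\<lambda>k. k \<noteq> i) U)"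

definition linf_space ::
    "(nat \<Rightarrow> ('k, 'a, 'm) normed_module_scheme) \<Rightarrow> ('k, nat \<Rightarrow> 'a) normed_module" where
  "linf_space X =
     \<lparr>carrier = {x. (\<forall>n. x n \<in> carrier (X n)) \<and> bdd_above (range (\<lambda>n. vnorm (X n) (x n)))},
      monoid.mult = undefined, one = undefined,
      ring.zero = (\<lambda>n. \<zero>\<^bsub>X n\<^esub>),
      add = (\<lambda>x y n. x n \<oplus>\<^bsub>X n\<^esub> y n),
      smult = (\<lambda>a x n. a \<odot>\<^bsub>X n\<^esub> x n),
      vnorm = (\<lambda>x. SUP n. vnorm (X n) (x n))\<rparr>"

definition c0_subspace ::
    "nat filter \<Rightarrow> (nat \<Rightarrow> ('k, 'a, 'm) normed_module_scheme) \<Rightarrow> (nat \<Rightarrow> 'a) set" where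
  "c0_subspace U X =
     {x \<in> carrier (linf_space X). ((\<lambda>n. vnorm (X n) (x n)) \<longlongrightarrow> 0) U}"

text \<open>
  For a closed subspace \<open>W\<close>; the elements are the cosets of \<open>W\<close>, the norm is the quotient norm.
\<close>

definition quotient_space ::
    "('k, 'a, 'm) normed_module_scheme \<Rightarrow> 'a set \<Rightarrow> ('k, 'a set) normed_module" where
  "quotient_space V W =
     \<lparr>carrier = a_rcosets\<^bsub>V\<^esub> W,
      monoid.mult = undefined, one = undefined,
      ring.zero = W,
      add = set_add V,
      smult = (\<lambda>a A. \<Union>x\<in>A. W +>\<^bsub>V\<^esub> (a \<odot>\<^bsub>V\<^esub> x)),
      vnorm = (\<lambda>A. INF x\<in>A. vnorm V x)\<rparr>"

definition ultraproduct ::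
    "nat filter \<Rightarrow> (nat \<Rightarrow> ('k, 'a, 'm) normed_module_scheme) \<Rightarrow>
      ('k, (nat \<Rightarrow> 'a) set) normed_module" where
  "ultraproduct U X = quotient_space (linf_space X) (c0_subspace U X)"

end

theory Submission
  imports Defs
begin

text \<open>
  The proof is by contradiction. Write \<open>\<gamma> = \<alpha> - \<epsilon>\<close>. If the claim fails for \<open>\<delta>\<close>, then for every \<open>n\<close> the
  set of those \<open>k\<close> for which some point of the sphere of \<open>X k\<close> has distance at least \<open>\<delta> / 2\<close> from
  \<open>conv_n (X k) n (S_mid (X k) \<gamma>)\<close> belongs to the ultrafilter \<open>U\<close>. As the sets \<open>conv_n\<close> increase with \<open>n\<close>,
  a diagonal choice yields one sequence \<open>x\<close> in the unit balls that does this for every \<open>n\<close> at once, each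
  time for \<open>U\<close>-almost all \<open>k\<close> (\<open>diagonal_far_sequence\<close>).

  The class of \<open>x\<close> lies in the unit ball of the ultraproduct. Let \<open>K\<close> be the set of classes of bounded
  sequences which lie in \<open>conv_n (X k) m (S_mid (X k) \<gamma>)\<close> for some fixed \<open>m\<close> and \<open>U\<close>-almost all \<open>k\<close>. It is
  convex, and it has distance at least \<open>\<delta> / 2\<close> from the class of \<open>x\<close>. It contains the midpoints of the
  ultraproduct for every \<open>\<beta> > \<gamma>\<close>: two points of the ball at distance at least \<open>\<beta>\<close> have representatives in
  the balls of the \<open>X k\<close>, and these are at distance at least \<open>\<gamma>\<close> for \<open>U\<close>-almost all \<open>k\<close>.

  On the other hand such a \<open>K\<close> has distance zero from every point of the ball if all slices have diameter
  greater than \<open>\<beta>\<close> (\<open>midpoints_dense_if_slices_large\<close>): a functional that separates a point of the ball from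
  \<open>K\<close> by a gap \<open>\<eta>\<close> defines a slice of depth \<open>\<eta>\<close>, which contains two points at distance greater than \<open>\<beta>\<close>;
  the functional takes a value at their midpoint that is too large for an element of \<open>K\<close>. With
  \<open>\<beta> = \<alpha> - \<epsilon> / 2\<close> this is the contradiction.

  The separating functional comes from a Hahn-Banach theorem on explicit carriers, whose proof uses Zorn's
  lemma on sublinear functionals instead of partially defined linear ones: a minimal sublinear functional
  is linear.
\<close>

section \<open>Elementary facts on normed spaces\<close>

lemma scalar_ring_simps [simp]:
  "carrier scalar_ring = UNIV" "a \<otimes>\<^bsub>scalar_ring\<^esub> b = a * b" "a \<oplus>\<^bsub>scalar_ring\<^esub> b = a + b"
  "\<one>\<^bsub>scalar_ring\<^esub> = 1" "\<zero>\<^bsub>scalar_ring\<^esub> = 0"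
  by (simp_all add: scalar_ring_def)

context normed_space
begin

lemma smult_in_carrier [simp, intro]: "x \<in> carrier V \<Longrightarrow> a \<odot> x \<in> carrier V"
  using smult_closed by simp

lemma smult_add_left: "x \<in> carrier V \<Longrightarrow> (a + b) \<odot> x = a \<odot> x \<oplus> b \<odot> x"
  using smult_l_distr by simp

lemma smult_add_right:
  "x \<in> carrier V \<Longrightarrow> y \<in> carrier V \<Longrightarrow> a \<odot> (x \<oplus> y) = a \<odot> x \<oplus> a \<odot> y"
  using smult_r_distr by simp

lemma smult_smult [simp]: "x \<in> carrier V \<Longrightarrow> a \<odot> (b \<odot> x) = (a * b) \<odot> x"
  using smult_assoc1 by simp

lemma smult_1 [simp]: "x \<in> carrier V \<Longrightarrow> 1 \<odot> x = x"
  using smult_one by simp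

lemma smult_0 [simp]: "x \<in> carrier V \<Longrightarrow> 0 \<odot> x = \<zero>"
  using smult_l_null by simp

lemma smult_zero [simp]: "a \<odot> \<zero> = \<zero>"
  using smult_r_null by simp

lemma a_inv_eq_smult: "x \<in> carrier V \<Longrightarrow> \<ominus> x = (- 1) \<odot> x"
proof -
  assume x: "x \<in> carrier V"
  have "(- 1) \<odot> x \<oplus> x = (- 1 + 1) \<odot> x"
    using x by (simp only: smult_add_left smult_1)
  then show ?thesis
    using x by (intro minus_equality) simp_all
qed

lemma vnorm_zero [simp]: "vnorm V \<zero> = 0"
  by (simp add: vnorm_eq_zero_iff)

lemma vnorm_a_inv [simp]: "x \<in> carrier V \<Longrightarrow> vnorm V (\<ominus> x) = vnorm V x"
  by (simp add: a_inv_eq_smult vnorm_smult)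

lemma vnorm_nonneg [simp]: "x \<in> carrier V \<Longrightarrow> 0 \<le> vnorm V x"
  using vnorm_triangle[of x "\<ominus> x"] by (simp add: r_neg)

end

section \<open>Sublinear functionals and the Hahn-Banach theorem\<close>

context normed_space
begin

text \<open>
  The inequality for multiples is enough: applied with \<open>t\<close> and \<open>1 / t\<close> it gives equality.
\<close>
definition sublinear :: "('a \<Rightarrow> real) \<Rightarrow> bool" where
  "sublinear q \<longleftrightarrow>
     (\<forall>x\<in>carrier V. \<forall>y\<in>carrier V. q (x \<oplus> y) \<le> q x + q y) \<and>
     (\<forall>t>0. \<forall>x\<in>carrier V. q (of_real t \<odot> x) \<le> t * q x)"

definition vconvex :: "'a set \<Rightarrow> bool" where
  "vconvex K \<longleftrightarrow> (\<forall>x\<in>K. \<forall>y\<in>K. \<forall>t\<in>{0..1}. of_real t \<odot> x \<oplus> of_real (1 - t) \<odot> y \<in> K)"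

lemma sublinear_add:
  "sublinear q \<Longrightarrow> x \<in> carrier V \<Longrightarrow> y \<in> carrier V \<Longrightarrow> q (x \<oplus> y) \<le> q x + q y"
  by (simp add: sublinear_def)

lemma sublinear_zero:
  assumes "sublinear q" shows "q \<zero> = 0"
proof -
  have "q \<zero> \<le> t * q \<zero>" if "t > 0" for t
    using assms that unfolding sublinear_def by (metis smult_zero zero_closed)
  from this[of 2] this[of "1/2"] show ?thesis by simp
qed

lemma sublinear_scale:
  assumes "sublinear q" "x \<in> carrier V" "t \<ge> 0"
  shows "q (of_real t \<odot> x) = t * q x"
proof (cases "t = 0")
  case True
  then show ?thesis using assms sublinear_zero by simp
next
  case False
  then have t: "t > 0" using assms by simp
  have "q (of_real (1 / t) \<odot> (of_real t \<odot> x)) \<le> (1 / t) * q (of_real t \<odot> x)"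
    using assms t unfolding sublinear_def by (meson smult_in_carrier zero_less_divide_1_iff)
  moreover have "of_real (1 / t) \<odot> (of_real t \<odot> x) = x"
    using t assms by (simp flip: of_real_mult)
  ultimately have "t * q x \<le> q (of_real t \<odot> x)"
    using t by (simp add: field_simps)
  moreover have "q (of_real t \<odot> x) \<le> t * q x"
    using assms t by (simp add: sublinear_def)
  ultimately show ?thesis by simp
qed

lemma sublinear_minus_ge:
  assumes "sublinear q" "x \<in> carrier V"
  shows "- q (\<ominus> x) \<le> q x"
  using sublinear_add[OF assms(1), of x "\<ominus> x"] sublinear_zero[OF assms(1)] assms(2)
  by (simp add: r_neg)

lemma sublinear_vnorm: "sublinear (vnorm V)"
  by (simp add: sublinear_def vnorm_triangle vnorm_smult)

end

lemma le_cINF_add: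
  fixes f :: "'a \<Rightarrow> real" and g :: "'b \<Rightarrow> real"
  assumes "A \<noteq> {}" "B \<noteq> {}" "\<And>a b. a \<in> A \<Longrightarrow> b \<in> B \<Longrightarrow> c \<le> f a + g b"
  shows "c \<le> (INF a\<in>A. f a) + (INF b\<in>B. g b)"
proof -
  have "c - g b \<le> (INF a\<in>A. f a)" if "b \<in> B" for b
    using assms that by (intro cINF_greatest) (auto simp: algebra_simps)
  then have "c - (INF a\<in>A. f a) \<le> (INF b\<in>B. g b)"
    using assms by (intro cINF_greatest) (auto simp: algebra_simps)
  then show ?thesis by simp
qed

lemma le_mult_cINF:
  fixes f :: "'a \<Rightarrow> real"
  assumes "A \<noteq> {}" "s > 0" "\<And>a. a \<in> A \<Longrightarrow> c \<le> s * f a"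
  shows "c \<le> s * (INF a\<in>A. f a)"
proof -
  have "c / s \<le> (INF a\<in>A. f a)"
    using assms by (intro cINF_greatest) (auto simp: field_simps)
  then show ?thesis using assms by (simp add: field_simps)
qed

context normed_space
begin

text \<open>
  The functional \<open>p z = inf (q (z + t w) - t \<eta>)\<close>, over \<open>t \<ge> 0\<close> and \<open>w \<in> K\<close>, is the largest sublinear functional
  below \<open>q\<close> with \<open>p (- w) \<le> - \<eta>\<close> on \<open>K\<close>. The infimum is finite since
  \<open>q (z + t w) \<ge> t q w - q (- z) \<ge> t \<eta> - q (- z)\<close>; convexity of \<open>K\<close> makes the vectors \<open>t w\<close> closed under
  addition, hence \<open>p\<close> subadditive. The construction serves two purposes: a single point \<open>K = {y}\<close> with
  \<open>\<eta> = q y\<close> shows that minimal sublinear functionals are odd, and a convex set yields a separating functional.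
\<close>
lemma sublinear_lowering:
  assumes q: "sublinear q" and K: "K \<subseteq> carrier V" "K \<noteq> {}" "vconvex K"
    and \<eta>: "\<And>w. w \<in> K \<Longrightarrow> \<eta> \<le> q w"
  obtains p where "sublinear p" "\<And>x. x \<in> carrier V \<Longrightarrow> p x \<le> q x" "\<And>w. w \<in> K \<Longrightarrow> p (\<ominus> w) \<le> - \<eta>"
proof -
  define F where "F z a = q (z \<oplus> of_real (fst a) \<odot> snd a) - fst a * \<eta>" for z a
  define I where "I = {0::real..} \<times> K"
  define p where "p z = (INF a\<in>I. F z a)" for z
  have I: "I \<noteq> {}" using K by (auto simp: I_def)
  have bdd: "bdd_below (F z ` I)" if z: "z \<in> carrier V" for z
  proof (rule bdd_belowI2)
    fix a assume a: "a \<in> I"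
    obtain t w where tw: "a = (t, w)" "t \<ge> 0" "w \<in> K" "w \<in> carrier V"
      using a K by (auto simp: I_def)
    have "of_real t \<odot> w = (z \<oplus> of_real t \<odot> w) \<oplus> \<ominus> z"
      using tw z by (metis a_comm add.inv_closed r_neg1 smult_in_carrier add.m_closed)
    then have "q (of_real t \<odot> w) \<le> q (z \<oplus> of_real t \<odot> w) + q (\<ominus> z)"
      using tw z sublinear_add[OF q, of "z \<oplus> of_real t \<odot> w" "\<ominus> z"] by simp
    moreover have "t * \<eta> \<le> q (of_real t \<odot> w)"
      using tw \<eta> by (simp add: sublinear_scale[OF q] mult_left_mono)
    ultimately show "- q (\<ominus> z) \<le> F z a"
      by (simp add: F_def tw)
  qed
  have le: "p z \<le> q (z \<oplus> of_real t \<odot> w) - t * \<eta>" if "z \<in> carrier V" "t \<ge> 0" "w \<in> K" for z t w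
    using cINF_lower[OF bdd[OF that(1)], of "(t, w)"] that by (simp add: p_def F_def I_def)
  show thesis
  proof
    show "sublinear p"
      unfolding sublinear_def
    proof (intro conjI ballI allI impI)
      fix x y assume xy: "x \<in> carrier V" "y \<in> carrier V"
      show "p (x \<oplus> y) \<le> p x + p y"
        unfolding p_def[of x] p_def[of y]
      proof (rule le_cINF_add[OF I I])
        fix a b assume "a \<in> I" "b \<in> I"
        then obtain s v t w where *: "a = (s, v)" "s \<ge> 0" "v \<in> K" "b = (t, w)" "t \<ge> 0" "w \<in> K"
          by (auto simp: I_def)
        have vw: "v \<in> carrier V" "w \<in> carrier V" using * K by auto
        \<comment> \<open>\<open>s v + t w\<close> is a multiple of the point of \<open>K\<close> that divides the segment from \<open>w\<close> to \<open>v\<close> in the ratio \<open>s : t\<close>\<close>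
        obtain u where u: "u \<in> K" "of_real (s + t) \<odot> u = of_real s \<odot> v \<oplus> of_real t \<odot> w"
        proof (cases "s + t = 0")
          case True
          then have "s = 0" "t = 0" using * by auto
          then show ?thesis using * vw that[of v] by simp
        next
          case False
          then have st: "s + t > 0" using * by simp
          define u where "u = of_real (s / (s + t)) \<odot> v \<oplus> of_real (1 - s / (s + t)) \<odot> w"
          have "s / (s + t) \<in> {0..1}"
            using * st by simp
          then have "u \<in> K"
            using K(3) * unfolding u_def vconvex_def by blast
          have "(s + t) * (1 - s / (s + t)) = t" "(s + t) * (s / (s + t)) = s"
            using st by (simp_all add: field_simps)
          then have "of_real (s + t) \<odot> u = of_real s \<odot> v \<oplus> of_real t \<odot> w"
            using vw by (simp add: u_def smult_add_right flip: of_real_mult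
                del: of_real_add of_real_divide of_real_diff)
          with \<open>u \<in> K\<close> show ?thesis by (rule that)
        qed
        have "p (x \<oplus> y) \<le> q ((x \<oplus> y) \<oplus> of_real (s + t) \<odot> u) - (s + t) * \<eta>"
          using xy * u by (intro le) auto
        also have "(x \<oplus> y) \<oplus> of_real (s + t) \<odot> u = (x \<oplus> of_real s \<odot> v) \<oplus> (y \<oplus> of_real t \<odot> w)"
          using xy vw by (simp add: u a_ac del: of_real_add)
        also have "q \<dots> \<le> q (x \<oplus> of_real s \<odot> v) + q (y \<oplus> of_real t \<odot> w)"
          using xy vw by (intro sublinear_add[OF q]) auto
        finally show "p (x \<oplus> y) \<le> F x a + F y b"
          by (simp add: F_def * algebra_simps)
      qed
    next
      fix s :: real and x assume s: "0 < s" and x: "x \<in> carrier V"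
      show "p (of_real s \<odot> x) \<le> s * p x"
        unfolding p_def[of x]
      proof (rule le_mult_cINF[OF I s])
        fix a assume "a \<in> I"
        then obtain t w where *: "a = (t, w)" "t \<ge> 0" "w \<in> K" "w \<in> carrier V"
          using K by (auto simp: I_def)
        have "p (of_real s \<odot> x) \<le> q (of_real s \<odot> x \<oplus> of_real (s * t) \<odot> w) - s * t * \<eta>"
          using x s * by (intro le) auto
        also have "of_real s \<odot> x \<oplus> of_real (s * t) \<odot> w = of_real s \<odot> (x \<oplus> of_real t \<odot> w)"
          using x * by (simp add: smult_add_right)
        also have "q \<dots> = s * q (x \<oplus> of_real t \<odot> w)"
          using x * s by (intro sublinear_scale[OF q]) auto
        finally show "p (of_real s \<odot> x) \<le> s * F x a"
          by (simp add: F_def * algebra_simps)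
      qed
    qed
  next
    fix x assume x: "x \<in> carrier V"
    obtain w where "w \<in> K" using K by auto
    then show "p x \<le> q x"
      using le[OF x, of 0 w] x K by auto
  next
    fix w assume w: "w \<in> K"
    then have "w \<in> carrier V" using K by auto
    then show "p (\<ominus> w) \<le> - \<eta>"
      using le[of "\<ominus> w" 1 w] w sublinear_zero[OF q] by (simp add: l_neg)
  qed
qed

text \<open>
  Zorn's lemma, with pointwise infima as lower bounds of chains; they are finite because
  \<open>q x \<ge> - q (- x) \<ge> - p (- x)\<close> for every sublinear \<open>q \<le> p\<close>.
\<close>
lemma exists_minimal_sublinear:
  assumes p: "sublinear p"
  obtains q where "sublinear q" "\<And>x. x \<in> carrier V \<Longrightarrow> q x \<le> p x"
    "\<And>r x. sublinear r \<Longrightarrow> (\<And>x. x \<in> carrier V \<Longrightarrow> r x \<le> q x) \<Longrightarrow> x \<in> carrier V \<Longrightarrow> r x = q x"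
proof -
  define A where "A = {q. sublinear q \<and> (\<forall>x\<in>carrier V. q x \<le> p x) \<and> (\<forall>x. x \<notin> carrier V \<longrightarrow> q x = 0)}"
  define P where "P q r \<longleftrightarrow> (\<forall>x. r x \<le> q x)" for q r :: "'a \<Rightarrow> real"
  \<comment> \<open>values outside of the carrier are fixed to be zero, so that the pointwise order is antisymmetric\<close>
  define cut where "cut q = (\<lambda>x. if x \<in> carrier V then q x else 0)" for q :: "'a \<Rightarrow> real"
  have cut_sub: "sublinear (cut q)" if "sublinear q" for q
    using that by (auto simp: sublinear_def cut_def)
  have "\<exists>m\<in>A. \<forall>a\<in>A. P m a \<longrightarrow> a = m"
  proof (rule predicate_Zorn)
    show "partial_order_on A (relation_of P A)"
      by (rule partial_order_on_relation_ofI)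
        (auto simp: P_def fun_eq_iff intro: order_trans antisym)
  next
    fix C assume C: "C \<in> Chains (relation_of P A)"
    have CA: "C \<subseteq> A" and chain: "\<And>q r. q \<in> C \<Longrightarrow> r \<in> C \<Longrightarrow> P q r \<or> P r q"
      using C by (auto simp: Chains_def relation_of_def)
    show "\<exists>u\<in>A. \<forall>a\<in>C. P a u"
    proof (cases "C = {}")
      case True
      then show ?thesis using cut_sub[OF p] by (intro bexI[of _ "cut p"]) (auto simp: A_def cut_def)
    next
      case False
      define u where "u x = (INF q\<in>C. q x)" for x
      have bdd: "bdd_below ((\<lambda>q. q x) ` C)" for x
      proof (rule bdd_belowI2)
        fix q assume "q \<in> C"
        then have q: "q \<in> A" using CA by auto
        show "(if x \<in> carrier V then - p (\<ominus> x) else 0) \<le> q x"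
        proof (cases "x \<in> carrier V")
          case True
          then have "q (\<ominus> x) \<le> p (\<ominus> x)" "- q (\<ominus> x) \<le> q x"
            using q sublinear_minus_ge[of q x] by (auto simp: A_def)
          then show ?thesis using True by simp
        qed (use q in \<open>simp add: A_def\<close>)
      qed
      have le: "u x \<le> q x" if "q \<in> C" for q x
        unfolding u_def by (rule cINF_lower[OF bdd that])
      have "sublinear u"
        unfolding sublinear_def
      proof (intro conjI ballI allI impI)
        fix x y assume xy: "x \<in> carrier V" "y \<in> carrier V"
        show "u (x \<oplus> y) \<le> u x + u y"
          unfolding u_def[of x] u_def[of y]
        proof (rule le_cINF_add[OF False False])
          fix q r assume qr: "q \<in> C" "r \<in> C"
          \<comment> \<open>one of the two chain members lies below the other\<close>
          obtain s where s: "s \<in> C" "s x \<le> q x" "s y \<le> r y"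
            using chain[OF qr] qr unfolding P_def by (metis order_refl)
          have "u (x \<oplus> y) \<le> s (x \<oplus> y)" using le s by blast
          also have "\<dots> \<le> s x + s y"
            using s CA xy by (intro sublinear_add) (auto simp: A_def)
          finally show "u (x \<oplus> y) \<le> q x + r y" using s by linarith
        qed
      next
        fix t :: real and x assume t: "0 < t" and x: "x \<in> carrier V"
        show "u (of_real t \<odot> x) \<le> t * u x"
          unfolding u_def[of x]
        proof (rule le_mult_cINF[OF False t])
          fix q assume q: "q \<in> C"
          have "u (of_real t \<odot> x) \<le> q (of_real t \<odot> x)" using le q by blast
          also have "\<dots> \<le> t * q x"
            using q CA t x by (auto simp: A_def sublinear_def)
          finally show "u (of_real t \<odot> x) \<le> t * q x" .
        qed
      qed
      moreover obtain q where q: "q \<in> C" using False by auto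
      moreover have "u x \<le> p x" if "x \<in> carrier V" for x
      proof -
        have "u x \<le> q x" using le q by blast
        also have "q x \<le> p x" using q CA that by (auto simp: A_def)
        finally show ?thesis .
      qed
      moreover have "u x = 0" if "x \<notin> carrier V" for x
      proof -
        have "(INF q\<in>C. q x) = (INF q\<in>C. 0)"
          using that CA by (intro INF_cong) (auto simp: A_def)
        then show ?thesis using False by (simp add: u_def)
      qed
      ultimately have "u \<in> A" by (simp add: A_def)
      then show ?thesis using le by (auto simp: P_def)
    qed
  qed
  then obtain m where m: "m \<in> A" "\<And>a. a \<in> A \<Longrightarrow> P m a \<Longrightarrow> a = m" by blast
  show thesis
  proof
    show "sublinear m" using m by (simp add: A_def)
    show "m x \<le> p x" if "x \<in> carrier V" for x using m that by (simp add: A_def)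
    fix r x assume r: "sublinear r" "\<And>x. x \<in> carrier V \<Longrightarrow> r x \<le> m x" and x: "x \<in> carrier V"
    have "cut r \<in> A"
      using cut_sub[OF r(1)] r(2) m(1) by (force simp: A_def cut_def)
    moreover have "P m (cut r)"
      using r(2) m(1) by (auto simp: P_def A_def cut_def)
    ultimately have "cut r = m" by (rule m(2))
    then show "r x = m x" using x by (auto simp: cut_def dest: fun_cong)
  qed
qed

text \<open>
  A minimal sublinear \<open>q\<close> cannot be lowered, so lowering it at a single point \<open>y\<close> with \<open>\<eta> = q y\<close> returns \<open>q\<close>
  and gives \<open>q (- y) \<le> - q y\<close>. An odd sublinear functional is linear.
\<close>
theorem hahn_banach_sublinear:
  assumes p: "sublinear p"
  obtains g where "\<And>x y. x \<in> carrier V \<Longrightarrow> y \<in> carrier V \<Longrightarrow> g (x \<oplus> y) = g x + g y"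
    "\<And>t x. x \<in> carrier V \<Longrightarrow> g (of_real t \<odot> x) = t * g x"
    "\<And>x. x \<in> carrier V \<Longrightarrow> g x \<le> p x"
proof -
  obtain q where q: "sublinear q" and qp: "\<And>x. x \<in> carrier V \<Longrightarrow> q x \<le> p x"
    and min: "\<And>r x. sublinear r \<Longrightarrow> (\<And>x. x \<in> carrier V \<Longrightarrow> r x \<le> q x) \<Longrightarrow> x \<in> carrier V \<Longrightarrow> r x = q x"
    by (rule exists_minimal_sublinear[OF p]) blast
  have odd: "q (\<ominus> y) = - q y" if y: "y \<in> carrier V" for y
  proof -
    have "vconvex {y}"
      using y by (auto simp: vconvex_def simp flip: smult_add_left of_real_add)
    then obtain r where r: "sublinear r" "\<And>x. x \<in> carrier V \<Longrightarrow> r x \<le> q x" "r (\<ominus> y) \<le> - q y"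
      using sublinear_lowering[OF q, of "{y}" "q y"] y by auto
    then have "q (\<ominus> y) \<le> - q y"
      using min[of r "\<ominus> y"] y by simp
    then show ?thesis
      using sublinear_minus_ge[OF q, of y] y by simp
  qed
  show thesis
  proof
    fix x y assume xy: "x \<in> carrier V" "y \<in> carrier V"
    have "q ((x \<oplus> y) \<oplus> \<ominus> y) \<le> q (x \<oplus> y) + q (\<ominus> y)"
      using xy by (intro sublinear_add[OF q]) auto
    then show "q (x \<oplus> y) = q x + q y"
      using xy odd sublinear_add[OF q, of x y] by (simp add: a_assoc r_neg)
  next
    fix t x assume x: "x \<in> carrier V"
    show "q (of_real t \<odot> x) = t * q x"
    proof (cases "t \<ge> 0")
      case True
      then show ?thesis using sublinear_scale[OF q x] by simp
    next
      case False
      have "of_real t \<odot> x = \<ominus> (of_real (- t) \<odot> x)"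
        using x by (simp add: a_inv_eq_smult)
      then show ?thesis
        using sublinear_scale[OF q x, of "- t"] False x odd[of "of_real (- t) \<odot> x"] by simp
    qed
  qed (rule qp)
qed

end

section \<open>Separation by scalar-valued functionals\<close>

text \<open>
  In the second case the real and imaginary parts are unique because \<open>c = d i\<close> with real \<open>c\<close> and \<open>d\<close> forces
  \<open>c\<^sup>2 = - d\<^sup>2\<close>.
\<close>
lemma re_part_cases:
  obtains (real) "\<And>z :: 'k::real_or_complex. of_real (re_part z) = z"
  | (complex) i :: "'k::real_or_complex" and im :: "'k \<Rightarrow> real" where "i * i = - 1"
    "\<And>z. of_real (re_part z) + of_real (im z) * i = z"
    "\<And>a b. re_part (of_real a + of_real b * i) = a"
proof -
  consider "\<forall>z::'k. z = re_part z *\<^sub>R 1" | "\<exists>i::'k. i * i = - 1 \<and>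
       (\<forall>z. \<exists>b. z = re_part z *\<^sub>R 1 + b *\<^sub>R i \<and>
              norm z = sqrt ((re_part z)\<^sup>2 + b\<^sup>2))"
    using real_or_complex by blast
  then show thesis
  proof cases
    case 1
    then show thesis using real by (simp add: of_real_def)
  next
    case 2
    then obtain i :: 'k where i: "i * i = - 1" and
      ex: "\<And>z. \<exists>b. of_real (re_part z) + of_real b * i = z"
      by (metis scaleR_conv_of_real mult.right_neutral)
    from ex obtain im where im: "\<And>z. of_real (re_part z) + of_real (im z) * i = z"
      by metis
    have uniq: "re_part (of_real a + of_real b * i) = a" for a b
    proof -
      define z where "z = of_real a + of_real b * i"
      have "of_real (a - re_part z) = of_real (im z - b) * i"
        using im[of z] by (simp add: z_def algebra_simps)
      then have "of_real (a - re_part z) * of_real (a - re_part z)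
          = (of_real (im z - b) * i) * (of_real (im z - b) * i)"
        by simp
      also have "\<dots> = of_real ((im z - b) * (im z - b)) * (i * i)"
        by (simp only: of_real_mult ac_simps)
      also have "\<dots> = of_real (- ((im z - b) * (im z - b)))"
        by (simp add: i)
      finally have "(a - re_part z) * (a - re_part z) = - ((im z - b) * (im z - b))"
        unfolding of_real_mult[symmetric] of_real_eq_iff .
      then have "(a - re_part z)\<^sup>2 + (im z - b)\<^sup>2 = 0"
        by (simp add: power2_eq_square)
      then show ?thesis
        by (simp add: z_def)
    qed
    show thesis using complex i im uniq by blast
  qed
qed

context normed_space
begin

text \<open>
  Over the reals \<open>f = g\<close>; over the complex numbers \<open>f x = g x - i g (i x)\<close>, which commutes with the
  multiplication by \<open>i\<close> and so is complex linear.
\<close>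
lemma real_functional_is_re_part:
  fixes g :: "'a \<Rightarrow> real"
  assumes add: "\<And>x y. x \<in> carrier V \<Longrightarrow> y \<in> carrier V \<Longrightarrow> g (x \<oplus> y) = g x + g y"
    and scale: "\<And>t x. x \<in> carrier V \<Longrightarrow> g (of_real t \<odot> x) = t * g x"
    and le: "\<And>x. x \<in> carrier V \<Longrightarrow> g x \<le> vnorm V x"
  obtains f where "f \<in> dual V" "\<And>x. x \<in> carrier V \<Longrightarrow> re_part (f x) = g x"
proof -
  have abs: "\<bar>g x\<bar> \<le> vnorm V x" if x: "x \<in> carrier V" for x
    using le[OF x] le[of "of_real (- 1) \<odot> x"] scale[OF x, of "- 1"] x
    by (simp add: vnorm_smult)
  show thesis
  proof (cases rule: re_part_cases[where ?'k = 'k])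
    case real
    define f where "f x = (of_real (g x) :: 'k)" for x
    have "f (a \<odot> x) = a * f x" if "x \<in> carrier V" for a x
      using scale[OF that, of "re_part a"] by (simp add: f_def real)
    moreover have "norm (f x) \<le> 1 * vnorm V x" if "x \<in> carrier V" for x
      using abs[OF that] by (simp add: f_def)
    ultimately have "f \<in> dual V"
      unfolding dual_def by (auto simp: f_def add intro!: exI[of _ 1])
    moreover have "re_part (f x) = g x" for x
      using real[of "f x"] by (simp only: f_def of_real_eq_iff)
    ultimately show thesis by (intro that)
  next
    case (complex i im)
    define f where "f x = (of_real (g x) + of_real (- g (i \<odot> x)) * i :: 'k)" for x
    have f_add: "f (x \<oplus> y) = f x + f y" if "x \<in> carrier V" "y \<in> carrier V" for x y
      using that by (simp add: f_def add smult_add_right algebra_simps)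
    have f_smult: "f (a \<odot> x) = a * f x" if x: "x \<in> carrier V" for a x
    proof -
      define p r where "p = re_part a" and "r = im a"
      have a: "a = of_real p + of_real r * i" unfolding p_def r_def by (simp add: complex(2))
      have "a \<odot> x = of_real p \<odot> x \<oplus> of_real r \<odot> (i \<odot> x)"
        using x by (simp add: a smult_add_left)
      then have 1: "g (a \<odot> x) = p * g x + r * g (i \<odot> x)"
        using x by (simp only: add scale smult_in_carrier)
      have ia: "i * a = of_real p * i + of_real (- r)"
      proof -
        have "i * a = of_real p * i + of_real r * (i * i)"
          unfolding a by (simp only: distrib_left ac_simps)
        then show ?thesis by (simp add: complex(1))
      qed
      have "i \<odot> (a \<odot> x) = of_real p \<odot> (i \<odot> x) \<oplus> of_real (- r) \<odot> x"
        using x by (simp only: smult_smult ia smult_add_left)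
      then have 2: "g (i \<odot> (a \<odot> x)) = p * g (i \<odot> x) - r * g x"
        using x by (simp add: add scale del: of_real_minus smult_smult)
      have "a * f x = of_real p * of_real (g x) + of_real p * of_real (- g (i \<odot> x)) * i
          + of_real r * of_real (g x) * i + of_real r * of_real (- g (i \<odot> x)) * (i * i)"
        unfolding f_def a by (simp only: distrib_left distrib_right ac_simps)
      then show ?thesis
        unfolding f_def 1 2 complex(1) by (simp add: algebra_simps)
    qed
    have "norm (f x) \<le> (1 + norm i * norm i) * vnorm V x" if x: "x \<in> carrier V" for x
    proof -
      have "norm (f x) \<le> \<bar>g x\<bar> + \<bar>g (i \<odot> x)\<bar> * norm i"
        unfolding f_def by (rule order_trans[OF norm_triangle_ineq]) (simp add: norm_mult)
      also have "\<dots> \<le> vnorm V x + vnorm V (i \<odot> x) * norm i"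
        using x abs by (intro add_mono mult_right_mono) auto
      finally show ?thesis using x by (simp add: vnorm_smult algebra_simps)
    qed
    then have "f \<in> dual V"
      unfolding dual_def using f_add f_smult by blast
    moreover have "re_part (f x) = g x" for x
      unfolding f_def by (rule complex(3))
    ultimately show thesis by (intro that)
  qed
qed

text \<open>
  Lower the norm along the convex set of all differences \<open>x0 - y\<close>, then pass to a linear functional \<open>g\<close> below
  the result; from \<open>g (- (x0 - y)) \<le> - \<eta>\<close> it separates by at least \<open>\<eta>\<close>.
\<close>
theorem separation:
  assumes K: "K \<subseteq> carrier V" "vconvex K" and x0: "x0 \<in> carrier V"
    and \<eta>: "\<And>y. y \<in> K \<Longrightarrow> \<eta> \<le> vdist V x0 y"
  obtains f where "f \<in> dual V" "\<And>x. x \<in> carrier V \<Longrightarrow> re_part (f x) \<le> vnorm V x"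
    "\<And>y. y \<in> K \<Longrightarrow> re_part (f y) + \<eta> \<le> re_part (f x0)"
proof -
  define D where "D = (\<lambda>y. x0 \<oplus> (- 1) \<odot> y) ` K"
  have D: "D \<subseteq> carrier V" using K x0 by (auto simp: D_def)
  have conv: "vconvex D"
    unfolding vconvex_def D_def
  proof (intro ballI, elim imageE, hypsubst)
    fix t :: real and y z assume t: "t \<in> {0..1}" and yz: "y \<in> K" "z \<in> K"
    have c: "y \<in> carrier V" "z \<in> carrier V" using yz K by auto
    define w where "w = of_real t \<odot> y \<oplus> of_real (1 - t) \<odot> z"
    have w: "w \<in> K" unfolding w_def using K(2) yz t by (simp add: vconvex_def)
    have "of_real t \<odot> x0 \<oplus> of_real (1 - t) \<odot> x0 = x0"
      using x0 by (simp flip: smult_add_left of_real_add)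
    then have "x0 \<oplus> (- 1) \<odot> w = (of_real t \<odot> x0 \<oplus> of_real (1 - t) \<odot> x0) \<oplus> (- 1) \<odot> w"
      by simp
    then have "of_real t \<odot> (x0 \<oplus> (- 1) \<odot> y) \<oplus> of_real (1 - t) \<odot> (x0 \<oplus> (- 1) \<odot> z) = x0 \<oplus> (- 1) \<odot> w"
      using x0 c unfolding w_def by (simp add: smult_add_right a_ac del: of_real_diff)
    then show "of_real t \<odot> (x0 \<oplus> (- 1) \<odot> y) \<oplus> of_real (1 - t) \<odot> (x0 \<oplus> (- 1) \<odot> z)
        \<in> (\<lambda>y. x0 \<oplus> (- 1) \<odot> y) ` K"
      using w by simp
  qed
  have le: "\<eta> \<le> vnorm V w" if "w \<in> D" for w
    using that \<eta> K by (auto simp: D_def vdist_def a_minus_def a_inv_eq_smult subset_iff)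
  obtain p where p: "sublinear p" "\<And>x. x \<in> carrier V \<Longrightarrow> p x \<le> vnorm V x" "\<And>w. w \<in> D \<Longrightarrow> p (\<ominus> w) \<le> - \<eta>"
  proof (cases "D = {}")
    case True
    then show ?thesis using that[OF sublinear_vnorm] by simp
  next
    case False
    then show ?thesis using sublinear_lowering[OF sublinear_vnorm D False conv le] that by blast
  qed
  obtain g where add: "\<And>x y. x \<in> carrier V \<Longrightarrow> y \<in> carrier V \<Longrightarrow> g (x \<oplus> y) = g x + g y"
    and scale: "\<And>t x. x \<in> carrier V \<Longrightarrow> g (of_real t \<odot> x) = t * g x"
    and gp: "\<And>x. x \<in> carrier V \<Longrightarrow> g x \<le> p x"
    by (rule hahn_banach_sublinear[OF p(1)]) blast
  have g_le: "g x \<le> vnorm V x" if "x \<in> carrier V" for x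
    using gp[OF that] p(2)[OF that] by simp
  obtain f where f: "f \<in> dual V" "\<And>x. x \<in> carrier V \<Longrightarrow> re_part (f x) = g x"
    using real_functional_is_re_part[OF add scale g_le] by blast
  have "g y + \<eta> \<le> g x0" if y: "y \<in> K" for y
  proof -
    define w where "w = x0 \<oplus> (- 1) \<odot> y"
    have w: "w \<in> D" "w \<in> carrier V" using y D by (auto simp: D_def w_def)
    have "g (\<ominus> w) = - g w"
      using scale[OF w(2), of "- 1"] w by (simp add: a_inv_eq_smult)
    moreover have "g w = g x0 - g y"
      using scale[of y "- 1"] add[of x0 "(- 1) \<odot> y"] x0 y K by (auto simp: w_def)
    ultimately show ?thesis
      using gp[of "\<ominus> w"] p(3)[OF w(1)] w by simp
  qed
  then show thesis
    using f x0 K(1) g_le by (intro that[of f]) (simp_all add: subset_iff)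
qed

text \<open>
  If \<open>x0\<close> had distance at least \<open>\<eta>\<close> from \<open>K\<close>, a functional \<open>f\<close> would separate it by a gap \<open>\<eta>\<close>. The slice
  of depth \<open>\<eta>\<close> given by \<open>f\<close> contains two points at distance greater than \<open>\<beta>\<close>. Their midpoint lies in \<open>K\<close>,
  but by linearity it also satisfies the inequality that defines the slice, so that \<open>f\<close> is larger there
  than the separation permits.
\<close>
theorem midpoints_dense_if_slices_large:
  assumes slices: "\<And>S. S \<in> slices V \<Longrightarrow> \<alpha> \<le> vdiameter V S" and "0 < \<alpha>" "\<beta> < \<alpha>"
    and K: "K \<subseteq> carrier V" "vconvex K" "S_mid V \<beta> \<subseteq> K"
    and x0: "x0 \<in> unit_ball V" and "\<eta> > 0"
  shows "\<exists>y\<in>K. vdist V x0 y < \<eta>"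
proof (rule ccontr)
  assume contra: "\<not> (\<exists>y\<in>K. vdist V x0 y < \<eta>)"
  have "x0 \<in> carrier V" using x0 by (simp add: unit_ball_def)
  moreover have "\<eta> \<le> vdist V x0 y" if "y \<in> K" for y using contra that by force
  ultimately obtain f where f: "f \<in> dual V" "\<And>x. x \<in> carrier V \<Longrightarrow> re_part (f x) \<le> vnorm V x"
    "\<And>y. y \<in> K \<Longrightarrow> re_part (f y) + \<eta> \<le> re_part (f x0)"
    using separation[OF K(1,2)] by blast
  define s where "s = (SUP y\<in>unit_ball V. re_part (f y))"
  define S where "S = {x \<in> unit_ball V. re_part (f x) > s - \<eta>}"
  have "bdd_above ((\<lambda>y. re_part (f y)) ` unit_ball V)"
    by (rule bdd_aboveI2[of _ _ 1]) (metis (lifting) f(2) mem_Collect_eq order_trans unit_ball_def)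
  then have s: "re_part (f x0) \<le> s"
    unfolding s_def using x0 by (intro cSUP_upper)
  have "S \<in> slices V"
    using f(1) \<open>\<eta> > 0\<close> unfolding slices_def S_def s_def by blast
  then have "\<alpha> \<le> vdiameter V S" by (rule slices)
  define dists where "dists = (\<lambda>(x, y). vdist V x y) ` (S \<times> S)"
  have "S \<noteq> {}"
    using \<open>\<alpha> \<le> vdiameter V S\<close> \<open>0 < \<alpha>\<close> by (auto simp: vdiameter_def)
  then have "dists \<noteq> {}" "\<beta> < Sup dists"
    using \<open>\<alpha> \<le> vdiameter V S\<close> \<open>\<beta> < \<alpha>\<close> by (simp_all add: vdiameter_def dists_def)
  then have "\<exists>d\<in>dists. \<beta> < d"
    by (rule less_cSupD)
  then have "\<exists>x\<in>S. \<exists>y\<in>S. \<beta> < vdist V x y"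
    by (simp add: dists_def)
  then obtain x y where xy: "x \<in> S" "y \<in> S" "\<beta> < vdist V x y"
    by (elim bexE)
  have ball: "x \<in> unit_ball V" "y \<in> unit_ball V" using xy by (auto simp: S_def)
  then have car: "x \<in> carrier V" "y \<in> carrier V" by (auto simp: unit_ball_def)
  define z where "z = (1 / 2) \<odot> (x \<oplus> y)"
  have "z \<in> S_mid V \<beta>"
    using ball xy(3) unfolding S_mid_def z_def by force
  then have "re_part (f z) + \<eta> \<le> s"
    using f(3) K(3) s by force
  moreover have "2 * re_part (f z) = re_part (f x) + re_part (f y)"
  proof -
    have re_add: "re_part (a + b) = re_part a + re_part b" for a b :: 'k
    proof (cases rule: re_part_cases[where ?'k = 'k])
      case real
      have "of_real (re_part (a + b)) = (of_real (re_part a + re_part b) :: 'k)"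
        by (simp add: real)
      then show ?thesis unfolding of_real_eq_iff .
    next
      case (complex i im)
      have "a + b = of_real (re_part a + re_part b) + of_real (im a + im b) * i"
        using complex(2)[of a] complex(2)[of b] by (simp add: algebra_simps)
      then show ?thesis using complex(3) by metis
    qed
    have f_add: "f (a \<oplus> b) = f a + f b" if "a \<in> carrier V" "b \<in> carrier V" for a b
      using f(1) that by (simp add: dual_def)
    have f_smult: "f (c \<odot> a) = c * f a" if "a \<in> carrier V" for a c
      using f(1) that by (simp add: dual_def)
    have "f x + f y = f z + f z"
      using car by (simp add: z_def f_add f_smult)
    then have "re_part (f x + f y) = re_part (f z + f z)" by simp
    then show ?thesis unfolding re_add by simp
  qed
  ultimately show False
    using xy by (auto simp: S_def)
qed

end

section \<open>Quotients by closed subspaces\<close>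

text \<open>
  Since \<open>W\<close> is symmetric, the second assumption says that a vector at distance zero from \<open>W\<close> belongs to \<open>W\<close>;
  it makes the quotient seminorm a norm.
\<close>
locale closed_submodule = normed_space V
  for V :: "('k::real_or_complex, 'a, 'm) normed_module_scheme" (structure) +
  fixes W
  assumes submodule: "submodule W scalar_ring V"
    and closed: "\<And>x. x \<in> carrier V \<Longrightarrow> (\<And>e. e > 0 \<Longrightarrow> \<exists>w\<in>W. vnorm V (w \<oplus> x) < e) \<Longrightarrow> x \<in> W"
begin

abbreviation "Q \<equiv> quotient_space V W"

lemma subset: "W \<subseteq> carrier V"
  using submoduleE(1)[OF submodule] .

lemma W_is_abelian_subgroup: "abelian_subgroup W V"
  using submodule.axioms(1)[OF submodule]
  by (intro abelian_subgroupI3 additive_subgroup.intro abelian_group_axioms)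

interpretation W: abelian_subgroup W V
  by (rule W_is_abelian_subgroup)

lemma coset_subset: "x \<in> carrier V \<Longrightarrow> W +> x \<subseteq> carrier V"
  using subset by (auto simp: a_r_coset_def')

lemma coset_nonempty: "W +> x \<noteq> {}"
  using W.zero_closed unfolding a_r_coset_def' by blast

lemma quotient_carrier: "carrier Q = (\<lambda>x. W +> x) ` carrier V"
  by (auto simp: quotient_space_def A_RCOSETS_def')

lemma coset_in_quotient [simp]: "x \<in> carrier V \<Longrightarrow> W +> x \<in> carrier Q"
  by (simp add: quotient_carrier)

lemma quotient_zero: "\<zero>\<^bsub>Q\<^esub> = W"
  by (simp add: quotient_space_def)

lemma coset_zero: "W +> \<zero> = W"
  using subset by (rule a_coset_add_zero)

lemma quotient_add:
  "x \<in> carrier V \<Longrightarrow> y \<in> carrier V \<Longrightarrow> (W +> x) \<oplus>\<^bsub>Q\<^esub> (W +> y) = W +> (x \<oplus> y)"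
  using W.a_rcos_sum by (simp add: quotient_space_def)

lemma coset_eq: "x \<in> carrier V \<Longrightarrow> w \<in> W \<Longrightarrow> W +> (w \<oplus> x) = W +> x"
  using W.a_repr_independence'[of "w \<oplus> x" x] by (auto simp: a_r_coset_def')

lemma quotient_smult:
  assumes "x \<in> carrier V" shows "a \<odot>\<^bsub>Q\<^esub> (W +> x) = W +> (a \<odot> x)"
proof -
  have "W +> (a \<odot> y) = W +> (a \<odot> x)" if y: "y \<in> W +> x" for y
  proof -
    obtain w where w: "w \<in> W" "y = w \<oplus> x" using y by (auto simp: a_r_coset_def')
    then have "a \<odot> y = a \<odot> w \<oplus> a \<odot> x"
      using assms subset by (auto simp: smult_add_right)
    moreover have "a \<odot> w \<in> W"
      using submodule.smult_closed[OF submodule] w by simp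
    ultimately show ?thesis using assms by (simp add: coset_eq)
  qed
  then have "(\<Union>y\<in>W +> x. W +> (a \<odot> y)) = (\<Union>y\<in>W +> x. W +> (a \<odot> x))" by simp
  then show ?thesis using coset_nonempty by (simp add: quotient_space_def)
qed

lemma quotient_norm: "vnorm Q A = (INF x\<in>A. vnorm V x)"
  by (simp add: quotient_space_def)

lemma quotient_norm_lower: "A \<in> carrier Q \<Longrightarrow> x \<in> A \<Longrightarrow> vnorm Q A \<le> vnorm V x"
  unfolding quotient_norm
  by (rule cINF_lower[OF bdd_belowI2[of _ 0]]) (use coset_subset in \<open>force simp: quotient_carrier\<close>)

lemma quotient_norm_less_iff:
  assumes "x \<in> carrier V"
  shows "vnorm Q (W +> x) < c \<longleftrightarrow> (\<exists>w\<in>W. vnorm V (w \<oplus> x) < c)"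
proof -
  have "vnorm Q (W +> x) < c \<longleftrightarrow> (\<exists>y\<in>W +> x. vnorm V y < c)"
    unfolding quotient_norm
    by (rule cINF_less_iff[OF coset_nonempty bdd_belowI2[of _ 0]])
      (use coset_subset[OF assms] in auto)
  then show ?thesis by (auto simp: a_r_coset_def')
qed

theorem quotient_is_normed_space: "normed_space Q"
proof -
  have grp: "abelian_group Q"
  proof (rule abelian_groupI)
    fix A assume "A \<in> carrier Q"
    then obtain x where x: "x \<in> carrier V" "A = W +> x" by (auto simp: quotient_carrier)
    then have "(W +> (\<ominus> x)) \<oplus>\<^bsub>Q\<^esub> A = \<zero>\<^bsub>Q\<^esub>"
      by (simp add: quotient_add l_neg coset_zero quotient_zero)
    then show "\<exists>B\<in>carrier Q. B \<oplus>\<^bsub>Q\<^esub> A = \<zero>\<^bsub>Q\<^esub>" using x by auto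
  next
    show "\<zero>\<^bsub>Q\<^esub> \<in> carrier Q"
      using coset_in_quotient[of \<zero>] by (simp add: coset_zero quotient_zero)
    show "\<zero>\<^bsub>Q\<^esub> \<oplus>\<^bsub>Q\<^esub> A = A" if "A \<in> carrier Q" for A
      using that quotient_add[of \<zero>] by (auto simp: quotient_carrier coset_zero quotient_zero)
  qed (auto simp: quotient_carrier quotient_add a_ac)
  interpret Q: abelian_group Q by (rule grp)
  have "module scalar_ring Q"
  proof (rule moduleI)
    show "cring (scalar_ring :: 'k ring)" by (rule R.is_cring)
  qed (use grp in \<open>auto simp: quotient_carrier quotient_smult quotient_add
      smult_add_left smult_add_right\<close>)
  moreover have "normed_space_axioms Q"
  proof
    fix A assume "A \<in> carrier Q"
    then obtain x where x: "x \<in> carrier V" "A = W +> x" by (auto simp: quotient_carrier)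
    show "vnorm Q A = 0 \<longleftrightarrow> A = \<zero>\<^bsub>Q\<^esub>"
    proof
      assume "vnorm Q A = 0"
      then have "\<exists>w\<in>W. vnorm V (w \<oplus> x) < e" if "e > 0" for e
        using that x quotient_norm_less_iff[of x e] by simp
      then have "x \<in> W" using closed x by blast
      then show "A = \<zero>\<^bsub>Q\<^esub>"
        using coset_eq[of \<zero> x] coset_zero subset x by (auto simp: quotient_zero)
    next
      assume "A = \<zero>\<^bsub>Q\<^esub>"
      then have "vnorm Q A \<le> 0"
        using quotient_norm_lower[of A \<zero>] \<open>A \<in> carrier Q\<close> W.zero_closed
        by (simp add: quotient_zero)
      moreover have "0 \<le> vnorm Q A"
        unfolding quotient_norm x using coset_nonempty coset_subset[OF x(1)]
        by (intro cINF_greatest) auto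
      ultimately show "vnorm Q A = 0" by simp
    qed
  next
    fix A B assume AB: "A \<in> carrier Q" "B \<in> carrier Q"
    then have sub: "A \<noteq> {}" "B \<noteq> {}" "A \<subseteq> carrier V" "B \<subseteq> carrier V"
      using coset_nonempty coset_subset by (auto simp: quotient_carrier)
    show "vnorm Q (A \<oplus>\<^bsub>Q\<^esub> B) \<le> vnorm Q A + vnorm Q B"
      unfolding quotient_norm[of A] quotient_norm[of B]
    proof (rule le_cINF_add[OF sub(1,2)])
      fix x y assume xy: "x \<in> A" "y \<in> B"
      then have "x \<oplus> y \<in> A \<oplus>\<^bsub>Q\<^esub> B"
        by (auto simp: quotient_space_def set_add_def')
      then have "vnorm Q (A \<oplus>\<^bsub>Q\<^esub> B) \<le> vnorm V (x \<oplus> y)"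
        using AB by (intro quotient_norm_lower) auto
      also have "\<dots> \<le> vnorm V x + vnorm V y"
        using xy sub by (intro vnorm_triangle) auto
      finally show "vnorm Q (A \<oplus>\<^bsub>Q\<^esub> B) \<le> vnorm V x + vnorm V y" .
    qed
  next
    have le: "vnorm Q (W +> (a \<odot> x)) \<le> norm a * vnorm Q (W +> x)"
      if x: "x \<in> carrier V" and "a \<noteq> 0" for a x
      unfolding quotient_norm[of "W +> x"]
    proof (rule le_mult_cINF[OF coset_nonempty])
      show "0 < norm a" using that by simp
      fix y assume y: "y \<in> W +> x"
      then have yc: "y \<in> carrier V" using coset_subset x by auto
      have "a \<odot> y \<in> W +> (a \<odot> x)"
        using y x subset submodule.smult_closed[OF submodule]
        by (auto simp: a_r_coset_def' smult_add_right subset_iff)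
      then have "vnorm Q (W +> (a \<odot> x)) \<le> vnorm V (a \<odot> y)"
        using x by (intro quotient_norm_lower) auto
      then show "vnorm Q (W +> (a \<odot> x)) \<le> norm a * vnorm V y"
        using yc by (simp add: vnorm_smult)
    qed
    fix A and a :: 'k assume "A \<in> carrier Q"
    then obtain x where x: "x \<in> carrier V" "A = W +> x" by (auto simp: quotient_carrier)
    show "vnorm Q (a \<odot>\<^bsub>Q\<^esub> A) = norm a * vnorm Q A"
    proof (cases "a = 0")
      case True
      have "vnorm Q W \<le> 0"
        using quotient_norm_lower[of W \<zero>] W.zero_closed coset_in_quotient[of \<zero>]
        by (simp add: coset_zero)
      moreover have "0 \<le> vnorm Q W"
        unfolding quotient_norm using W.zero_closed subset
        by (intro cINF_greatest) (blast, auto)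
      ultimately show ?thesis
        using True x by (simp add: quotient_smult coset_zero)
    next
      case False
      have "vnorm Q (W +> (inverse a \<odot> (a \<odot> x))) \<le> norm (inverse a) * vnorm Q (W +> (a \<odot> x))"
        using x False by (intro le) auto
      then have "vnorm Q A \<le> vnorm Q (W +> (a \<odot> x)) / norm a"
        using x False by (simp add: norm_inverse divide_inverse mult.commute)
      then have "norm a * vnorm Q A \<le> vnorm Q (W +> (a \<odot> x))"
        using False by (simp add: pos_le_divide_eq mult.commute)
      then show ?thesis
        using le[OF x(1) False] x by (simp add: quotient_smult)
    qed
  qed
  ultimately show ?thesis by (rule normed_space.intro)
qed

end

section \<open>The space of bounded sequences\<close>

lemma linf_simps [simp]:
  "\<zero>\<^bsub>linf_space X\<^esub> = (\<lambda>n. \<zero>\<^bsub>X n\<^esub>)"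
  "x \<oplus>\<^bsub>linf_space X\<^esub> y = (\<lambda>n. x n \<oplus>\<^bsub>X n\<^esub> y n)"
  "a \<odot>\<^bsub>linf_space X\<^esub> x = (\<lambda>n. a \<odot>\<^bsub>X n\<^esub> x n)"
  by (simp_all add: linf_space_def)

locale normed_space_sequence =
  fixes X :: "nat \<Rightarrow> ('k::real_or_complex, 'a, 'm) normed_module_scheme"
  assumes normed: "\<And>n. normed_space (X n)"
begin

sublocale X: normed_space "X n" for n
  by (rule normed)

abbreviation "L \<equiv> linf_space X"

lemma linf_carrier_iff:
  "x \<in> carrier L \<longleftrightarrow> (\<forall>n. x n \<in> carrier (X n)) \<and> (\<exists>c. \<forall>n. vnorm (X n) (x n) \<le> c)"
  unfolding linf_space_def bdd_above_def by simp

lemma linf_component: "x \<in> carrier L \<Longrightarrow> x n \<in> carrier (X n)"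
  unfolding linf_carrier_iff by blast

lemma linf_norm: "vnorm L x = (SUP n. vnorm (X n) (x n))"
  by (simp add: linf_space_def)

lemma linf_norm_upper: "x \<in> carrier L \<Longrightarrow> vnorm (X n) (x n) \<le> vnorm L x"
  unfolding linf_norm by (rule cSUP_upper) (simp_all add: linf_space_def)

lemma linf_norm_le: "(\<And>n. vnorm (X n) (x n) \<le> c) \<Longrightarrow> vnorm L x \<le> c"
  unfolding linf_norm by (rule cSUP_least) simp_all

lemma linf_add_closed:
  assumes x: "x \<in> carrier L" and y: "y \<in> carrier L"
  shows "(\<lambda>n. x n \<oplus>\<^bsub>X n\<^esub> y n) \<in> carrier L"
proof -
  have "vnorm (X n) (x n \<oplus>\<^bsub>X n\<^esub> y n) \<le> vnorm L x + vnorm L y" for n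
    using X.vnorm_triangle[OF linf_component[OF x] linf_component[OF y], of n]
      linf_norm_upper[OF x, of n] linf_norm_upper[OF y, of n] by linarith
  then show ?thesis
    using x y unfolding linf_carrier_iff by blast
qed

lemma linf_smult_closed:
  assumes x: "x \<in> carrier L" shows "(\<lambda>n. a \<odot>\<^bsub>X n\<^esub> x n) \<in> carrier L"
proof -
  have "vnorm (X n) (a \<odot>\<^bsub>X n\<^esub> x n) \<le> norm a * vnorm L x" for n
    unfolding X.vnorm_smult[OF linf_component[OF x]]
    by (intro mult_left_mono linf_norm_upper[OF x] norm_ge_zero)
  then show ?thesis
    using x unfolding linf_carrier_iff by blast
qed

lemma linf_zero_closed: "(\<lambda>n. \<zero>\<^bsub>X n\<^esub>) \<in> carrier L"
  unfolding linf_carrier_iff by (intro conjI allI exI[of _ 0]) simp_all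

lemma linf_inv_closed:
  assumes x: "x \<in> carrier L" shows "(\<lambda>n. \<ominus>\<^bsub>X n\<^esub> x n) \<in> carrier L"
  using linf_smult_closed[OF x, of "- 1"] linf_component[OF x]
  by (simp only: X.a_inv_eq_smult)

lemma linf_is_normed_space: "normed_space L"
proof -
  have grp: "abelian_group L"
  proof (rule abelian_groupI)
    fix x y z assume xyz: "x \<in> carrier L" "y \<in> carrier L" "z \<in> carrier L"
    note [simp] = xyz[THEN linf_component]
    show "x \<oplus>\<^bsub>L\<^esub> y \<in> carrier L" "x \<oplus>\<^bsub>L\<^esub> y \<oplus>\<^bsub>L\<^esub> z = x \<oplus>\<^bsub>L\<^esub> (y \<oplus>\<^bsub>L\<^esub> z)" "x \<oplus>\<^bsub>L\<^esub> y = y \<oplus>\<^bsub>L\<^esub> x"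
      using linf_add_closed[OF xyz(1,2)] by (simp_all add: X.a_ac)
    have "(\<lambda>n. \<ominus>\<^bsub>X n\<^esub> x n) \<oplus>\<^bsub>L\<^esub> x = \<zero>\<^bsub>L\<^esub>" by (simp add: X.l_neg)
    then show "\<exists>y\<in>carrier L. y \<oplus>\<^bsub>L\<^esub> x = \<zero>\<^bsub>L\<^esub>" using linf_inv_closed[OF xyz(1)] by blast
    show "\<zero>\<^bsub>L\<^esub> \<oplus>\<^bsub>L\<^esub> x = x" by simp
  qed (simp add: linf_zero_closed)
  have "module scalar_ring L"
  proof (rule moduleI)
    show "cring (scalar_ring :: 'k ring)" by (rule X.R.is_cring)
    fix x y and a b :: 'k assume xy: "x \<in> carrier L" "y \<in> carrier L"
    note [simp] = xy[THEN linf_component]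
    show "a \<odot>\<^bsub>L\<^esub> x \<in> carrier L" using linf_smult_closed[OF xy(1)] by simp
    show "(a \<oplus>\<^bsub>scalar_ring\<^esub> b) \<odot>\<^bsub>L\<^esub> x = a \<odot>\<^bsub>L\<^esub> x \<oplus>\<^bsub>L\<^esub> b \<odot>\<^bsub>L\<^esub> x"
      "a \<odot>\<^bsub>L\<^esub> (x \<oplus>\<^bsub>L\<^esub> y) = a \<odot>\<^bsub>L\<^esub> x \<oplus>\<^bsub>L\<^esub> a \<odot>\<^bsub>L\<^esub> y"
      "(a \<otimes>\<^bsub>scalar_ring\<^esub> b) \<odot>\<^bsub>L\<^esub> x = a \<odot>\<^bsub>L\<^esub> (b \<odot>\<^bsub>L\<^esub> x)"
      "\<one>\<^bsub>scalar_ring\<^esub> \<odot>\<^bsub>L\<^esub> x = x"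
      by (simp_all add: X.smult_add_left X.smult_add_right)
  qed (rule grp)
  moreover have "normed_space_axioms L"
  proof
    fix x y and a :: 'k assume x: "x \<in> carrier L" and y: "y \<in> carrier L"
    note [simp] = x[THEN linf_component] y[THEN linf_component]
    show "vnorm L x = 0 \<longleftrightarrow> x = \<zero>\<^bsub>L\<^esub>"
    proof
      assume "vnorm L x = 0"
      then have "vnorm (X n) (x n) = 0" for n
        using linf_norm_upper[OF x, of n] by (simp add: antisym)
      then show "x = \<zero>\<^bsub>L\<^esub>" by (simp add: X.vnorm_eq_zero_iff fun_eq_iff)
    qed (simp add: linf_norm)
    show "vnorm L (x \<oplus>\<^bsub>L\<^esub> y) \<le> vnorm L x + vnorm L y"
    proof (rule linf_norm_le)
      fix n
      have "vnorm (X n) (x n \<oplus>\<^bsub>X n\<^esub> y n) \<le> vnorm (X n) (x n) + vnorm (X n) (y n)"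
        by (intro X.vnorm_triangle) simp_all
      also have "\<dots> \<le> vnorm L x + vnorm L y"
        using x y by (intro add_mono linf_norm_upper)
      finally show "vnorm (X n) ((x \<oplus>\<^bsub>L\<^esub> y) n) \<le> vnorm L x + vnorm L y" by simp
    qed
    have le: "vnorm L (a \<odot>\<^bsub>L\<^esub> x) \<le> norm a * vnorm L x"
      by (intro linf_norm_le) (simp add: X.vnorm_smult linf_norm_upper[OF x] mult_left_mono)
    have "norm a * vnorm L x \<le> vnorm L (a \<odot>\<^bsub>L\<^esub> x)" if "a \<noteq> 0"
    proof -
      have "vnorm L x \<le> vnorm L (a \<odot>\<^bsub>L\<^esub> x) / norm a"
      proof (rule linf_norm_le)
        fix n
        show "vnorm (X n) (x n) \<le> vnorm L (a \<odot>\<^bsub>L\<^esub> x) / norm a"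
          using linf_norm_upper[OF linf_smult_closed[OF x], of n a] that
          by (simp add: X.vnorm_smult pos_le_divide_eq mult.commute)
      qed
      then show ?thesis using that by (simp add: pos_le_divide_eq mult.commute)
    qed
    moreover
    have "0 \<le> vnorm (X 0) (a \<odot>\<^bsub>X 0\<^esub> x 0)"
      by simp
    then have "0 \<le> vnorm L (a \<odot>\<^bsub>L\<^esub> x)"
      using linf_norm_upper[OF linf_smult_closed[OF x], of 0 a] unfolding linf_simps
      by (rule order_trans)
    ultimately show "vnorm L (a \<odot>\<^bsub>L\<^esub> x) = norm a * vnorm L x"
      using le by (cases "a = 0") auto
  qed
  ultimately show ?thesis by (rule normed_space.intro)
qed

sublocale L: normed_space L
  by (rule linf_is_normed_space)

lemma linf_a_inv: "x \<in> carrier L \<Longrightarrow> \<ominus>\<^bsub>L\<^esub> x = (\<lambda>n. \<ominus>\<^bsub>X n\<^esub> x n)"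
  by (rule L.minus_equality) (simp_all add: linf_inv_closed X.l_neg linf_component[of x])

end

section \<open>The norm of the ultraproduct\<close>

locale ultraproduct_of_normed_spaces = normed_space_sequence X
  for X :: "nat \<Rightarrow> ('k::real_or_complex, 'a, 'm) normed_module_scheme" +
  fixes U :: "nat filter"
  assumes free: "free_ultrafilter U"
begin

lemma U_not_bot: "U \<noteq> bot"
  using free by (simp add: free_ultrafilter_def)

lemma not_eventually_iff: "\<not> eventually P U \<longleftrightarrow> eventually (\<lambda>n. \<not> P n) U"
proof
  show "\<not> eventually P U \<Longrightarrow> eventually (\<lambda>n. \<not> P n) U"
    using free unfolding free_ultrafilter_def by blast
  assume "eventually (\<lambda>n. \<not> P n) U"
  then show "\<not> eventually P U"
    using U_not_bot eventually_conj[of P U] by (auto simp: eventually_False dest: eventually_conj)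
qed

abbreviation "c0 \<equiv> c0_subspace U X"

lemma c0_iff: "w \<in> c0 \<longleftrightarrow> w \<in> carrier L \<and> (\<forall>e>0. eventually (\<lambda>n. vnorm (X n) (w n) < e) U)"
proof -
  have "\<bar>vnorm (X n) (w n)\<bar> = vnorm (X n) (w n)" if "w \<in> carrier L" for n
    using linf_component[OF that] by simp
  then show ?thesis
    unfolding c0_subspace_def tendsto_iff by (simp cong: conj_cong)
qed

text \<open>
  The norm of \<open>w\<close> is small along \<open>U\<close> and can be absorbed into the gap between the norm of \<open>w + x\<close> and \<open>c\<close>.
  Together with \<open>norm_cls_le\<close> below, this expresses that the quotient norm is the limit of the norms of the
  terms along \<open>U\<close>. It also shows that the null sequences form a closed subspace.
\<close>
lemma eventually_norm_less:
  assumes "w \<in> c0" "x \<in> carrier L" "vnorm L (w \<oplus>\<^bsub>L\<^esub> x) < c"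
  shows "eventually (\<lambda>n. vnorm (X n) (x n) < c) U"
proof -
  define e where "e = c - vnorm L (w \<oplus>\<^bsub>L\<^esub> x)"
  have w: "w \<in> carrier L" and "eventually (\<lambda>n. vnorm (X n) (w n) < e) U"
    using assms by (auto simp: c0_iff e_def)
  note [simp] = w[THEN linf_component] assms(2)[THEN linf_component]
  from \<open>eventually _ U\<close> show ?thesis
  proof (rule eventually_mono)
    fix n assume n: "vnorm (X n) (w n) < e"
    have "x n = (w n \<oplus>\<^bsub>X n\<^esub> x n) \<oplus>\<^bsub>X n\<^esub> \<ominus>\<^bsub>X n\<^esub> w n"
      by (simp add: X.a_comm[of "w n" n "x n"] X.a_assoc X.r_neg)
    then have "vnorm (X n) (x n) \<le> vnorm (X n) (w n \<oplus>\<^bsub>X n\<^esub> x n) + vnorm (X n) (w n)"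
      using X.vnorm_triangle[where n=n and x="w n \<oplus>\<^bsub>X n\<^esub> x n" and y="\<ominus>\<^bsub>X n\<^esub> w n"] by simp
    moreover have "vnorm (X n) (w n \<oplus>\<^bsub>X n\<^esub> x n) \<le> vnorm L (w \<oplus>\<^bsub>L\<^esub> x)"
      using linf_norm_upper[OF linf_add_closed[OF w assms(2)], of n] by simp
    ultimately show "vnorm (X n) (x n) < c"
      using n by (simp add: e_def)
  qed
qed

sublocale quot: closed_submodule L c0
proof (intro closed_submodule.intro closed_submodule_axioms.intro linf_is_normed_space)
  show "submodule c0 scalar_ring L"
  proof (rule L.submoduleI)
    show "\<zero>\<^bsub>L\<^esub> \<in> c0" by (simp add: c0_iff linf_zero_closed)
    show "\<ominus>\<^bsub>L\<^esub> x \<in> c0" if "x \<in> c0" for x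
      using that by (simp add: c0_iff linf_a_inv linf_inv_closed linf_component[of x])
    show "x \<oplus>\<^bsub>L\<^esub> y \<in> c0" if xy: "x \<in> c0" "y \<in> c0" for x y
      unfolding c0_iff
    proof (intro conjI allI impI)
      have car: "x \<in> carrier L" "y \<in> carrier L" using xy by (auto simp: c0_iff)
      note [simp] = car[THEN linf_component]
      show "x \<oplus>\<^bsub>L\<^esub> y \<in> carrier L" using car by (simp add: linf_add_closed)
      fix e :: real assume "e > 0"
      then have "e / 2 > 0" by simp
      then have "eventually (\<lambda>n. vnorm (X n) (x n) < e / 2) U" "eventually (\<lambda>n. vnorm (X n) (y n) < e / 2) U"
        using xy unfolding c0_iff by blast+
      then show "eventually (\<lambda>n. vnorm (X n) ((x \<oplus>\<^bsub>L\<^esub> y) n) < e) U"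
      proof eventually_elim
        case (elim n)
        then show ?case
          using X.vnorm_triangle[where n=n and x="x n" and y="y n"] by simp
      qed
    qed
    show "a \<odot>\<^bsub>L\<^esub> x \<in> c0" if x: "x \<in> c0" for a x
      unfolding c0_iff
    proof (intro conjI allI impI)
      have car: "x \<in> carrier L" using x by (auto simp: c0_iff)
      note [simp] = car[THEN linf_component]
      show "a \<odot>\<^bsub>L\<^esub> x \<in> carrier L" using car by (simp add: linf_smult_closed)
      fix e :: real assume e: "e > 0"
      have "e / (norm a + 1) > 0" using e by (simp add: add_nonneg_pos)
      then have "eventually (\<lambda>n. vnorm (X n) (x n) < e / (norm a + 1)) U"
        using x by (auto simp: c0_iff)
      then show "eventually (\<lambda>n. vnorm (X n) ((a \<odot>\<^bsub>L\<^esub> x) n) < e) U"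
      proof eventually_elim
        case (elim n)
        have "norm a * vnorm (X n) (x n) \<le> (norm a + 1) * vnorm (X n) (x n)"
          by (intro mult_right_mono) simp_all
        also have "\<dots> < e"
          using elim by (simp add: pos_less_divide_eq add_nonneg_pos mult.commute)
        finally show ?case by (simp add: X.vnorm_smult)
      qed
    qed
  qed (auto simp: c0_iff)
next
  fix x assume x: "x \<in> carrier L" and "\<And>e. e > 0 \<Longrightarrow> \<exists>w\<in>c0. vnorm L (w \<oplus>\<^bsub>L\<^esub> x) < e"
  then show "x \<in> c0"
    unfolding c0_iff using eventually_norm_less by blast
qed

abbreviation "UP \<equiv> ultraproduct U X"

sublocale UP: normed_space UP
  unfolding ultraproduct_def by (rule quot.quotient_is_normed_space)

definition cls :: "(nat \<Rightarrow> 'a) \<Rightarrow> (nat \<Rightarrow> 'a) set" where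
  "cls x = c0 +>\<^bsub>L\<^esub> x"

lemma UP_carrier: "carrier UP = cls ` carrier L"
  by (simp add: ultraproduct_def cls_def quot.quotient_carrier)

lemma cls_in_carrier [simp]: "x \<in> carrier L \<Longrightarrow> cls x \<in> carrier UP"
  by (simp add: UP_carrier)

lemma cls_add: "x \<in> carrier L \<Longrightarrow> y \<in> carrier L \<Longrightarrow> cls x \<oplus>\<^bsub>UP\<^esub> cls y = cls (\<lambda>n. x n \<oplus>\<^bsub>X n\<^esub> y n)"
  using quot.quotient_add[of x y] by (simp add: ultraproduct_def cls_def)

lemma cls_smult: "x \<in> carrier L \<Longrightarrow> a \<odot>\<^bsub>UP\<^esub> cls x = cls (\<lambda>n. a \<odot>\<^bsub>X n\<^esub> x n)"
  using quot.quotient_smult[of x a] by (simp add: ultraproduct_def cls_def)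

lemma norm_cls_less:
  "x \<in> carrier L \<Longrightarrow> vnorm UP (cls x) < c \<Longrightarrow> eventually (\<lambda>n. vnorm (X n) (x n) < c) U"
  using quot.quotient_norm_less_iff[of x c] eventually_norm_less[of _ x c]
  unfolding ultraproduct_def cls_def by blast

text \<open>
  Replacing by zero the terms whose norm exceeds \<open>c\<close> changes \<open>x\<close> by a sequence that vanishes along \<open>U\<close>, and
  the result has norm at most \<open>c\<close> in every term.
\<close>
lemma norm_cls_le:
  assumes x: "x \<in> carrier L" and ev: "eventually (\<lambda>n. vnorm (X n) (x n) \<le> c) U"
  shows "vnorm UP (cls x) \<le> c"
proof -
  note [simp] = x[THEN linf_component]
  obtain m where "vnorm (X m) (x m) \<le> c"
    using eventually_happens[OF ev] U_not_bot by auto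
  then have c: "0 \<le> c" by (meson X.vnorm_nonneg linf_component[OF x] order_trans)
  define w where "w n = (if vnorm (X n) (x n) \<le> c then \<zero>\<^bsub>X n\<^esub> else \<ominus>\<^bsub>X n\<^esub> x n)" for n
  have "vnorm (X n) (w n) \<le> vnorm L x" for n
    using linf_norm_upper[OF x, of n] order_trans[OF X.vnorm_nonneg linf_norm_upper[OF x], of n]
    unfolding w_def by (cases "vnorm (X n) (x n) \<le> c") simp_all
  then have wL: "w \<in> carrier L"
    unfolding linf_carrier_iff by (intro conjI allI exI[of _ "vnorm L x"]) (simp_all add: w_def)
  have w: "w \<in> c0"
    unfolding c0_iff using wL ev by (auto simp: w_def elim: eventually_mono)
  have "vnorm L (w \<oplus>\<^bsub>L\<^esub> x) \<le> c"
    using c by (intro linf_norm_le) (simp add: w_def X.l_neg)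
  moreover have "w \<oplus>\<^bsub>L\<^esub> x \<in> cls x"
    using w by (auto simp: cls_def a_r_coset_def')
  ultimately show ?thesis
    using quot.quotient_norm_lower[of "cls x" "w \<oplus>\<^bsub>L\<^esub> x"] x
    by (simp add: ultraproduct_def cls_def)
qed

lemma vdist_cls:
  assumes "x \<in> carrier L" "y \<in> carrier L"
  shows "vdist UP (cls x) (cls y) = vnorm UP (cls (\<lambda>n. x n \<ominus>\<^bsub>X n\<^esub> y n))"
    "(\<lambda>n. x n \<ominus>\<^bsub>X n\<^esub> y n) \<in> carrier L"
  using assms linf_add_closed[OF assms(1) linf_smult_closed[OF assms(2), of "- 1"]]
    assms[THEN linf_component]
  by (simp_all add: vdist_def a_minus_def UP.a_inv_eq_smult X.a_inv_eq_smult cls_smult cls_add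
      linf_smult_closed)

lemma vdist_cls_less:
  assumes "x \<in> carrier L" "y \<in> carrier L" "vdist UP (cls x) (cls y) < c"
  shows "eventually (\<lambda>n. vdist (X n) (x n) (y n) < c) U"
  using norm_cls_less[OF vdist_cls(2)[OF assms(1,2)]] assms(3)
  unfolding vdist_cls(1)[OF assms(1,2)] by (simp add: vdist_def)

lemma vdist_cls_le:
  assumes "x \<in> carrier L" "y \<in> carrier L" "eventually (\<lambda>n. vdist (X n) (x n) (y n) \<le> c) U"
  shows "vdist UP (cls x) (cls y) \<le> c"
  using norm_cls_le[OF vdist_cls(2)[OF assms(1,2)]] assms(3)
  unfolding vdist_cls(1)[OF assms(1,2)] by (simp add: vdist_def)

lemma unit_balls_subset: "(\<And>n. x n \<in> unit_ball (X n)) \<Longrightarrow> x \<in> carrier L"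
  unfolding linf_carrier_iff unit_ball_def by blast

text \<open>
  An arbitrary representative \<open>y\<close> is rescaled to \<open>y n / max 1 (vnorm (X n) (y n))\<close>. This moves its terms by at
  most \<open>max 1 (vnorm (X n) (y n)) - 1\<close>, which is small along \<open>U\<close> because the class has norm at most one.
\<close>
lemma unit_ball_lift:
  assumes "A \<in> unit_ball UP"
  obtains x where "\<And>n. x n \<in> unit_ball (X n)" "A = cls x"
proof -
  obtain y where y: "y \<in> carrier L" "A = cls y" "vnorm UP (cls y) \<le> 1"
    using assms unfolding unit_ball_def UP_carrier by blast
  note [simp] = y(1)[THEN linf_component]
  define M where "M n = max 1 (vnorm (X n) (y n))" for n
  define x where "x n = of_real (1 / M n) \<odot>\<^bsub>X n\<^esub> y n" for n
  have M: "M n \<ge> 1" "vnorm (X n) (y n) \<le> M n" for n by (auto simp: M_def)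
  have Mpos: "M n > 0" for n using M(1)[of n] by linarith
  have ball: "x n \<in> unit_ball (X n)" for n
    using M Mpos[of n] by (simp add: x_def unit_ball_def X.vnorm_smult norm_divide field_simps)
  have xL: "x \<in> carrier L" by (rule unit_balls_subset) (rule ball)
  have "vdist UP (cls y) (cls x) \<le> e" if e: "e > 0" for e
  proof (rule vdist_cls_le[OF y(1) xL])
    have "eventually (\<lambda>n. vnorm (X n) (y n) < 1 + e) U"
      using y e by (intro norm_cls_less) auto
    then show "eventually (\<lambda>n. vdist (X n) (y n) (x n) \<le> e) U"
    proof eventually_elim
      case (elim n)
      have "y n \<ominus>\<^bsub>X n\<^esub> x n = of_real (1 - 1 / M n) \<odot>\<^bsub>X n\<^esub> y n"
        using X.smult_add_left[where n=n and x="y n" and a=1 and b="- of_real (1 / M n)"]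
        by (simp add: x_def a_minus_def X.a_inv_eq_smult)
      then have "vdist (X n) (y n) (x n) = norm (of_real (1 - 1 / M n) :: 'k) * vnorm (X n) (y n)"
        by (simp add: vdist_def X.vnorm_smult del: of_real_diff)
      also have "norm (of_real (1 - 1 / M n) :: 'k) = 1 - 1 / M n"
        using M(1)[of n] Mpos[of n] unfolding norm_of_real by simp
      also have "(1 - 1 / M n) * vnorm (X n) (y n) \<le> (1 - 1 / M n) * M n"
        using M[of n] Mpos[of n] by (intro mult_left_mono) (auto simp: field_simps)
      also have "\<dots> = M n - 1"
        using Mpos[of n] by (simp add: field_simps)
      also have "\<dots> \<le> e"
        using elim e by (simp add: M_def)
      finally show ?case .
    qed
  qed
  moreover have "0 \<le> vdist UP (cls y) (cls x)"
    using y(1) xL by (simp add: vdist_def)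
  ultimately have "vdist UP (cls y) (cls x) = 0"
    by (metis field_le_epsilon add_0 antisym)
  then have "cls y \<ominus>\<^bsub>UP\<^esub> cls x = \<zero>\<^bsub>UP\<^esub>"
    using y(1) xL by (simp add: vdist_def UP.vnorm_eq_zero_iff)
  then have "cls y = cls x"
    using UP.minus_equality[of "cls y" "\<ominus>\<^bsub>UP\<^esub> cls x"] y(1) xL
    by (simp add: a_minus_def)
  then show thesis using that ball y by blast
qed

end

section \<open>Convex combinations of midpoints\<close>

context normed_space
begin

text \<open>
  The two families of weights and points are concatenated, with the weights multiplied by \<open>t\<close> and \<open>1 - t\<close>.
\<close>
lemma conv_n_combine:
  assumes C: "C \<subseteq> carrier V" and a: "a \<in> conv_n V n C" and b: "b \<in> conv_n V m C"
    and t: "t \<in> {0..1}"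
  shows "of_real t \<odot> a \<oplus> of_real (1 - t) \<odot> b \<in> conv_n V (n + m) C"
proof -
  obtain l x where a: "a = (\<Oplus>i\<in>{1..n}. of_real (l i) \<odot> x i)" and l: "\<And>i. i \<in> {1..n} \<Longrightarrow> l i \<in> {0..1}"
    "(\<Sum>i=1..n. l i) = 1" and x: "\<And>i. i \<in> {1..n} \<Longrightarrow> x i \<in> C"
    using a unfolding conv_n_def by blast
  obtain k y where b: "b = (\<Oplus>i\<in>{1..m}. of_real (k i) \<odot> y i)" and k: "\<And>i. i \<in> {1..m} \<Longrightarrow> k i \<in> {0..1}"
    "(\<Sum>i=1..m. k i) = 1" and y: "\<And>i. i \<in> {1..m} \<Longrightarrow> y i \<in> C"
    using b unfolding conv_n_def by blast
  have xC: "x i \<in> carrier V" if "i \<in> {1..n}" for i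
    using x[OF that] C by blast
  have yC: "y i \<in> carrier V" if "i \<in> {1..m}" for i
    using y[OF that] C by blast
  define c where "c i = (if i \<le> n then t * l i else (1 - t) * k (i - n))" for i
  define z where "z i = (if i \<le> n then x i else y (i - n))" for i
  have split: "{1..n + m} = {1..n} \<union> (\<lambda>i. i + n) ` {1..m}"
    by auto
  have disj: "{1..n} \<inter> (\<lambda>i. i + n) ` {1..m} = {}" by auto
  have inj: "inj_on (\<lambda>i. i + n) {1..m}" by simp
  have z: "z i \<in> C" if "i \<in> {1..n + m}" for i
    using that x[of i] y[of "i - n"] unfolding z_def by (cases "i \<le> n") (simp_all add: Suc_le_eq)
  have c01: "c i \<in> {0..1}" if "i \<in> {1..n + m}" for i
    using that l(1)[of i] k(1)[of "i - n"] t unfolding c_def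
    by (cases "i \<le> n") (simp_all add: Suc_le_eq mult_le_one)
  have summand: "of_real (c i) \<odot> z i \<in> carrier V" if "i \<in> {1..n + m}" for i
    using z[OF that] C by auto
  have "(\<Sum>i=1..n + m. c i) = (\<Sum>i=1..n. c i) + (\<Sum>i=1..m. c (i + n))"
    unfolding split sum.union_disjoint[OF finite_atLeastAtMost finite_imageI[OF finite_atLeastAtMost] disj]
      sum.reindex[OF inj] o_def ..
  also have "(\<Sum>i=1..n. c i) = t * (\<Sum>i=1..n. l i)"
    by (simp add: c_def sum_distrib_left)
  also have "(\<Sum>i=1..m. c (i + n)) = (1 - t) * (\<Sum>i=1..m. k i)"
    unfolding sum_distrib_left by (intro sum.cong) (auto simp: c_def)
  finally have c1: "(\<Sum>i=1..n + m. c i) = 1"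
    using l k by simp
  have "(\<Oplus>i\<in>{1..n + m}. of_real (c i) \<odot> z i)
      = (\<Oplus>i\<in>{1..n}. of_real (c i) \<odot> z i) \<oplus> (\<Oplus>i\<in>(\<lambda>i. i + n) ` {1..m}. of_real (c i) \<odot> z i)"
    unfolding split using disj summand split by (intro finsum_Un_disjoint) auto
  also have "(\<Oplus>i\<in>(\<lambda>i. i + n) ` {1..m}. of_real (c i) \<odot> z i)
      = (\<Oplus>i\<in>{1..m}. of_real (c (i + n)) \<odot> z (i + n))"
    using summand split inj by (intro finsum_reindex) auto
  also have "\<dots> = (\<Oplus>i\<in>{1..m}. of_real (1 - t) \<odot> (of_real (k i) \<odot> y i))"
    using yC by (intro finsum_cong') (auto simp: c_def z_def simp del: of_real_diff)
  also have "\<dots> = of_real (1 - t) \<odot> b"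
    unfolding b using yC by (intro finsum_smult_ldistr[symmetric]) auto
  also have "(\<Oplus>i\<in>{1..n}. of_real (c i) \<odot> z i) = (\<Oplus>i\<in>{1..n}. of_real t \<odot> (of_real (l i) \<odot> x i))"
    using xC by (intro finsum_cong') (auto simp: c_def z_def)
  also have "\<dots> = of_real t \<odot> a"
    unfolding a using xC by (intro finsum_smult_ldistr[symmetric]) auto
  finally show ?thesis
    unfolding conv_n_def using c01 c1 z by (intro CollectI exI[of _ c] exI[of _ z]) auto
qed

lemma conv_n_carrier:
  assumes "C \<subseteq> carrier V" shows "conv_n V n C \<subseteq> carrier V"
  using assms unfolding conv_n_def by (auto intro!: finsum_closed)

lemma conv_1: "C \<subseteq> carrier V \<Longrightarrow> a \<in> C \<Longrightarrow> a \<in> conv_n V 1 C"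
  unfolding conv_n_def by (intro CollectI exI[of _ "\<lambda>_. 1"] exI[of _ "\<lambda>_. a"]) auto

lemma conv_n_mono:
  assumes C: "C \<subseteq> carrier V" and a: "a \<in> conv_n V n C" and n: "1 \<le> n" "n \<le> m"
  shows "a \<in> conv_n V m C"
  using n(2)
proof (induction m rule: dec_induct)
  case (step m)
  obtain x where "\<forall>i\<in>{1..n}. x i \<in> C"
    using a unfolding conv_n_def by blast
  then have x: "x 1 \<in> C" using n by simp
  \<comment> \<open>pad with one more point, of weight zero; it exists because \<open>n\<close> is positive\<close>
  have "of_real 1 \<odot> a \<oplus> of_real (1 - 1) \<odot> x 1 \<in> conv_n V (m + 1) C"
    by (rule conv_n_combine[OF C step.IH conv_1[OF C x]]) simp
  moreover have "a \<in> carrier V" "x 1 \<in> carrier V" using a x C conv_n_carrier by auto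
  ultimately show ?case by simp
qed (rule a)

lemma S_mid_carrier: "S_mid V \<gamma> \<subseteq> carrier V"
  by (auto simp: S_mid_def unit_ball_def)

lemma far_point_if_C_const_ge:
  assumes "ereal \<delta> \<le> C_const V n \<gamma>" "\<eta> < \<delta>"
  obtains x where "x \<in> unit_ball V" "\<And>y. y \<in> conv_n V n (S_mid V \<gamma>) \<Longrightarrow> \<eta> \<le> vdist V x y"
proof -
  have "ereal \<eta> < C_const V n \<gamma>"
    using assms less_le_trans[of "ereal \<eta>" "ereal \<delta>"] by simp
  then obtain x where x: "x \<in> unit_sphere V"
    "ereal \<eta> < (INF y\<in>conv_n V n (S_mid V \<gamma>). ereal (vdist V x y))"
    unfolding C_const_def less_SUP_iff by blast
  have "\<eta> \<le> vdist V x y" if "y \<in> conv_n V n (S_mid V \<gamma>)" for y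
    using less_le_trans[OF x(2) INF_lower[OF that]] by simp
  moreover have "x \<in> unit_ball V" using x by (simp add: unit_ball_def unit_sphere_def)
  ultimately show thesis using that by blast
qed

end

section \<open>Transfer between the ultraproduct and its factors\<close>

context ultraproduct_of_normed_spaces
begin

text \<open>
  The loss from \<open>\<beta>\<close> to \<open>\<gamma>\<close> is needed because a norm at least \<open>\<beta>\<close> in the ultraproduct only says that the norms of
  the terms exceed each smaller number along \<open>U\<close>.
\<close>
lemma S_mid_lift:
  assumes A: "A \<in> S_mid UP \<beta>" and "\<gamma> < \<beta>"
  obtains z where "z \<in> carrier L" "A = cls z" "eventually (\<lambda>n. z n \<in> S_mid (X n) \<gamma>) U"
proof -
  obtain B C where BC: "A = (1 / 2) \<odot>\<^bsub>UP\<^esub> (B \<oplus>\<^bsub>UP\<^esub> C)" "B \<in> unit_ball UP" "C \<in> unit_ball UP" "\<beta> \<le> vdist UP B C"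
    using A unfolding S_mid_def by blast
  obtain x where x: "\<And>n. x n \<in> unit_ball (X n)" "B = cls x" using unit_ball_lift[OF BC(2)] by blast
  obtain y where y: "\<And>n. y n \<in> unit_ball (X n)" "C = cls y" using unit_ball_lift[OF BC(3)] by blast
  have L: "x \<in> carrier L" "y \<in> carrier L"
    using x y by (auto intro: unit_balls_subset)
  define z where "z = (\<lambda>n. (1 / 2) \<odot>\<^bsub>X n\<^esub> (x n \<oplus>\<^bsub>X n\<^esub> y n))"
  have zL: "z \<in> carrier L"
    unfolding z_def by (intro linf_smult_closed linf_add_closed L)
  have Az: "A = cls z"
    unfolding BC(1) x(2) y(2) cls_add[OF L] cls_smult[OF linf_add_closed[OF L]] z_def ..
  have "eventually (\<lambda>n. \<gamma> \<le> vdist (X n) (x n) (y n)) U"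
  proof (rule ccontr)
    assume "\<not> eventually (\<lambda>n. \<gamma> \<le> vdist (X n) (x n) (y n)) U"
    then have "eventually (\<lambda>n. vdist (X n) (x n) (y n) \<le> \<gamma>) U"
      unfolding not_eventually_iff by (rule eventually_mono) simp
    then have "vdist UP B C \<le> \<gamma>"
      unfolding x(2) y(2) by (rule vdist_cls_le[OF L])
    then show False using BC(4) \<open>\<gamma> < \<beta>\<close> by simp
  qed
  then have "eventually (\<lambda>n. z n \<in> S_mid (X n) \<gamma>) U"
    by (rule eventually_mono) (use x(1) y(1) in \<open>unfold S_mid_def z_def, blast\<close>)
  with zL Az show thesis by (rule that)
qed

text \<open>
  The number of points is bounded along the sequence, but not over the whole set; this makes the set convex.
\<close>
definition lifted_hull :: "real \<Rightarrow> (nat \<Rightarrow> 'a) set set" where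
  "lifted_hull \<gamma> = {cls z | z m. z \<in> carrier L \<and> 1 \<le> m \<and>
     eventually (\<lambda>n. z n \<in> conv_n (X n) m (S_mid (X n) \<gamma>)) U}"

lemma lifted_hull_convex: "UP.vconvex (lifted_hull \<gamma>)"
  unfolding UP.vconvex_def
proof (intro ballI)
  fix A B and t :: real assume "A \<in> lifted_hull \<gamma>" "B \<in> lifted_hull \<gamma>" and t: "t \<in> {0..1}"
  then obtain y k z m where y: "A = cls y" "y \<in> carrier L" "1 \<le> k"
      "eventually (\<lambda>n. y n \<in> conv_n (X n) k (S_mid (X n) \<gamma>)) U"
    and z: "B = cls z" "z \<in> carrier L" "1 \<le> m"
      "eventually (\<lambda>n. z n \<in> conv_n (X n) m (S_mid (X n) \<gamma>)) U"
    unfolding lifted_hull_def by blast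
  define w where "w = (\<lambda>n. of_real t \<odot>\<^bsub>X n\<^esub> y n \<oplus>\<^bsub>X n\<^esub> of_real (1 - t) \<odot>\<^bsub>X n\<^esub> z n)"
  have "w \<in> carrier L"
    unfolding w_def by (intro linf_add_closed linf_smult_closed y z)
  moreover have "of_real t \<odot>\<^bsub>UP\<^esub> A \<oplus>\<^bsub>UP\<^esub> of_real (1 - t) \<odot>\<^bsub>UP\<^esub> B = cls w"
    unfolding y(1) z(1) w_def cls_smult[OF y(2)] cls_smult[OF z(2)]
    by (rule cls_add[OF linf_smult_closed[OF y(2)] linf_smult_closed[OF z(2)]])
  moreover have "eventually (\<lambda>n. w n \<in> conv_n (X n) (k + m) (S_mid (X n) \<gamma>)) U"
    using y(4) z(4)
    by eventually_elim (unfold w_def, rule X.conv_n_combine[OF X.S_mid_carrier _ _ t])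
  ultimately show "of_real t \<odot>\<^bsub>UP\<^esub> A \<oplus>\<^bsub>UP\<^esub> of_real (1 - t) \<odot>\<^bsub>UP\<^esub> B \<in> lifted_hull \<gamma>"
    using y(3) unfolding lifted_hull_def by (intro CollectI exI[of _ w] exI[of _ "k + m"]) simp
qed

lemma S_mid_subset_lifted_hull:
  assumes "\<gamma> < \<beta>" shows "S_mid UP \<beta> \<subseteq> lifted_hull \<gamma>"
proof
  fix A assume "A \<in> S_mid UP \<beta>"
  then obtain z where z: "z \<in> carrier L" "A = cls z" "eventually (\<lambda>n. z n \<in> S_mid (X n) \<gamma>) U"
    using S_mid_lift assms by blast
  have "eventually (\<lambda>n. z n \<in> conv_n (X n) 1 (S_mid (X n) \<gamma>)) U"
    using z(3) by eventually_elim (rule X.conv_1[OF X.S_mid_carrier])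
  then show "A \<in> lifted_hull \<gamma>"
    using z unfolding lifted_hull_def by blast
qed

lemma eventually_ge: "eventually (\<lambda>n. m \<le> n) U"
proof -
  have "eventually (\<lambda>n. \<forall>i\<in>{..<m}. n \<noteq> i) U"
    using free by (intro eventually_ball_finite) (auto simp: free_ultrafilter_def)
  then show ?thesis
    by (rule eventually_mono) (metis lessThan_iff not_less)
qed

text \<open>
  For given \<open>k\<close>, take a point that is far for the largest \<open>n \<le> k\<close> at which \<open>C_const (X k) n \<gamma>\<close> is still
  large; by monotonicity it is far for all smaller \<open>n\<close> as well. The bound \<open>n \<le> k\<close> makes a largest \<open>n\<close>
  available, and holds for \<open>U\<close>-almost all \<open>k\<close> because \<open>U\<close> is free.
\<close>
lemma diagonal_far_sequence:
  assumes large: "\<And>n. 1 \<le> n \<Longrightarrow> eventually (\<lambda>k. ereal \<delta> \<le> C_const (X k) n \<gamma>) U" and "\<eta> < \<delta>"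
  obtains x where "\<And>k. x k \<in> unit_ball (X k)"
    "\<And>n. 1 \<le> n \<Longrightarrow>
       eventually (\<lambda>k. \<forall>y\<in>conv_n (X k) n (S_mid (X k) \<gamma>). \<eta> \<le> vdist (X k) (x k) y) U"
proof -
  define P where "P k n \<longleftrightarrow> 1 \<le> n \<and> n \<le> k \<and> ereal \<delta> \<le> C_const (X k) n \<gamma>" for k n
  have "\<exists>x\<in>unit_ball (X k). \<forall>n. P k n \<longrightarrow>
      (\<forall>y\<in>conv_n (X k) n (S_mid (X k) \<gamma>). \<eta> \<le> vdist (X k) x y)" for k
  proof (cases "\<exists>n. P k n")
    case True
    define N where "N = Max {n. P k n}"
    have fin: "finite {n. P k n}"
      by (rule finite_subset[of _ "{..k}"]) (auto simp: P_def)
    have N: "P k N"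
      using Max_in[OF fin] True unfolding N_def by blast
    then obtain x where x: "x \<in> unit_ball (X k)"
      "\<And>y. y \<in> conv_n (X k) N (S_mid (X k) \<gamma>) \<Longrightarrow> \<eta> \<le> vdist (X k) x y"
      using X.far_point_if_C_const_ge[of \<delta> k N \<gamma> \<eta>] \<open>\<eta> < \<delta>\<close> unfolding P_def by blast
    have "\<eta> \<le> vdist (X k) x y" if "P k n" "y \<in> conv_n (X k) n (S_mid (X k) \<gamma>)" for n y
    proof -
      have "n \<le> N" using fin that unfolding N_def by (intro Max_ge) auto
      then show ?thesis
        using x(2) X.conv_n_mono[OF X.S_mid_carrier that(2)] that(1) unfolding P_def by blast
    qed
    then show ?thesis using x(1) by blast
  next
    case False
    have "\<zero>\<^bsub>X k\<^esub> \<in> unit_ball (X k)" by (simp add: unit_ball_def)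
    then show ?thesis using False by blast
  qed
  then obtain x where x: "\<And>k. x k \<in> unit_ball (X k)"
    "\<And>k n y. P k n \<Longrightarrow> y \<in> conv_n (X k) n (S_mid (X k) \<gamma>) \<Longrightarrow> \<eta> \<le> vdist (X k) (x k) y"
    by metis
  show thesis
  proof (rule that[of x])
    fix n :: nat assume n: "1 \<le> n"
    show "eventually (\<lambda>k. \<forall>y\<in>conv_n (X k) n (S_mid (X k) \<gamma>). \<eta> \<le> vdist (X k) (x k) y) U"
      using large[OF n] eventually_ge[of n]
    proof eventually_elim
      case (elim k)
      then show ?case using n x(2)[of k n] by (auto simp: P_def)
    qed
  qed (rule x(1))
qed

theorem eventually_C_const_small:
  assumes slices: "\<And>S. S \<in> slices UP \<Longrightarrow> \<alpha> \<le> vdiameter UP S"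
    and "0 < \<alpha>" "0 < \<delta>" "0 < \<epsilon>"
  shows "\<exists>n\<ge>1. eventually (\<lambda>k. C_const (X k) n (\<alpha> - \<epsilon>) < ereal \<delta>) U"
proof (rule ccontr)
  define \<gamma> \<beta> where "\<gamma> = \<alpha> - \<epsilon>" and "\<beta> = \<alpha> - \<epsilon> / 2"
  have \<gamma>\<beta>: "\<gamma> < \<beta>" "\<beta> < \<alpha>" using \<open>0 < \<epsilon>\<close> by (simp_all add: \<gamma>_def \<beta>_def)
  assume contra: "\<not> (\<exists>n\<ge>1. eventually (\<lambda>k. C_const (X k) n (\<alpha> - \<epsilon>) < ereal \<delta>) U)"
  have large: "eventually (\<lambda>k. ereal \<delta> \<le> C_const (X k) n \<gamma>) U" if "1 \<le> n" for n
  proof -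
    have "\<not> eventually (\<lambda>k. C_const (X k) n \<gamma> < ereal \<delta>) U"
      using contra that unfolding \<gamma>_def by blast
    then show ?thesis unfolding not_eventually_iff not_less .
  qed
  obtain x where x: "\<And>k. x k \<in> unit_ball (X k)" and far: "\<And>n. 1 \<le> n \<Longrightarrow>
      eventually (\<lambda>k. \<forall>y\<in>conv_n (X k) n (S_mid (X k) \<gamma>). \<delta> / 2 \<le> vdist (X k) (x k) y) U"
    using diagonal_far_sequence[OF large, of "\<delta> / 2"] \<open>0 < \<delta>\<close> by auto
  have xL: "x \<in> carrier L" using x by (rule unit_balls_subset)
  have "vnorm UP (cls x) \<le> 1"
    by (rule norm_cls_le[OF xL]) (use x in \<open>simp add: unit_ball_def\<close>)
  then have ball: "cls x \<in> unit_ball UP"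
    using xL by (simp add: unit_ball_def)
  have sub: "lifted_hull \<gamma> \<subseteq> carrier UP"
    unfolding lifted_hull_def using cls_in_carrier by blast
  have "\<exists>A\<in>lifted_hull \<gamma>. vdist UP (cls x) A < \<delta> / 2"
    using \<open>0 < \<delta>\<close>
    by (intro UP.midpoints_dense_if_slices_large[OF slices \<open>0 < \<alpha>\<close> \<gamma>\<beta>(2) sub lifted_hull_convex
          S_mid_subset_lifted_hull[OF \<gamma>\<beta>(1)] ball]) simp_all
  then obtain z m where z: "z \<in> carrier L" "1 \<le> m" "vdist UP (cls x) (cls z) < \<delta> / 2"
    "eventually (\<lambda>n. z n \<in> conv_n (X n) m (S_mid (X n) \<gamma>)) U"
    unfolding lifted_hull_def by blast
  have "eventually (\<lambda>n. False) U"
    using vdist_cls_less[OF xL z(1,3)] z(4) far[OF z(2)]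
    by eventually_elim force
  then show False
    using U_not_bot by (simp add: eventually_False)
qed

end

theorem theorem3p1:
  fixes X :: "nat \<Rightarrow> ('k::real_or_complex, 'a) normed_module"
    and U :: "nat filter"
    and \<alpha> :: real
  assumes "\<And>k. banach_space (X k)"
    and "free_ultrafilter U"
    and "\<alpha> > 0"
    and "\<And>S. S \<in> slices (ultraproduct U X) \<Longrightarrow> vdiameter (ultraproduct U X) S \<ge> \<alpha>"
  shows "\<forall>\<delta>::real. \<forall>\<epsilon>::real. \<delta> > 0 \<longrightarrow> \<epsilon> > 0 \<longrightarrow>
    (\<exists>n\<ge>1. eventually (\<lambda>k. C_const (X k) n (\<alpha> - \<epsilon>) < ereal \<delta>) U)"
proof (intro allI impI)
  fix \<delta> \<epsilon> :: real assume "\<delta> > 0" "\<epsilon> > 0"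
  interpret ultraproduct_of_normed_spaces X U
    using assms(1,2) by (intro ultraproduct_of_normed_spaces.intro normed_space_sequence.intro
        ultraproduct_of_normed_spaces_axioms.intro banach_space.axioms(1))
  show "\<exists>n\<ge>1. eventually (\<lambda>k. C_const (X k) n (\<alpha> - \<epsilon>) < ereal \<delta>) U"
    using eventually_C_const_small[OF assms(4,3) \<open>\<delta> > 0\<close> \<open>\<epsilon> > 0\<close>] .
qed

end
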